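(* Let $\Omega\subset\mathbb{R}^N$ be a bounded open set and let $J$ satisfy (H0), (H0'), (H1) and (H2). Then the embedding $\mathcal{H}_{J,0}(\Omega)\hookrightarrow L^2(\Omega)$ is compact, i.e. every bounded subset of $\mathcal{H}_{J,0}(\Omega)$ (with respect to $\|\cdot\|_{\mathcal{H}_J}$) is relatively compact in $L^2(\Omega)$.
   Context: Standing setting: $N\ge1$, $\Omega\subset\mathbb{R}^N$ bounded open, $B_\varepsilon=\{z\in\mathbb{R}^N:|z|<\varepsilon\}$. (H0): $J:\mathbb{R}^N\times\mathbb{R}^N\to[0,\infty)$ is measurable, $J(x,y)=J(y,x)$, and $\sup_{x\in\mathbb{R}^N}\int_{\mathbb{R}^N}\min(1,|x-y|^2)J(x,y)\,dy<\infty$. (H0'): $J(x,y)\ge\mathcal{K}(x-y)\ge0$ for a measurable $\mathcal{K}:\mathbb{R}^N\to[0,\infty)$ with $\mathcal{K}\notin L^1(B_\varepsilon)$ for every $\varepsilon>0$. (H1): there exist $\rho>0$ and $\ell:(0,\rho)\to(0,\infty)$, bounded above and below by positive constants on $[\varepsilon,\rho)$ for every $\varepsilon\in(0,\rho)$, such that $\mathcal{K}(z)=|z|^{-N}\ell(|z|)$ for $0<|z|<\rho$ and $M(r):=\int_r^\rho\frac{\ell(s)}{s}\,ds\to\infty$ as $r\to0^+$. (H2): $\lim_{s\to0^+}\ell(\lambda s)/\ell(s)=1$ for every $\lambda>0$. Let $Q_\Omega=(\Omega^c\times\Omega^c)^c$ and $\mathcal{E}(u,v)=\frac12\iint_{Q_\Omega}(u(x)-u(y))(v(x)-v(y))J(x,y)\,dx\,dy$.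 $\mathcal{H}_J(\Omega)=\{u:\mathbb{R}^N\to\mathbb{R}$ measurable$:\ u|_\Omega\in L^2(\Omega),\ \mathcal{E}(u,u)<\infty\}$, $\mathcal{H}_{J,0}(\Omega)=\{u\in\mathcal{H}_J(\Omega): u=0$ a.e. in $\Omega^c\}$, with norm $\|u\|_{\mathcal{H}_J}=(\int_\Omega u^2+\mathcal{E}(u,u))^{1/2}$. *)

theory Defs
  imports "HOL-Analysis.Analysis"
begin

definition Q_set :: "'a set \<Rightarrow> ('a \<times> 'a) set" where
  "Q_set \<Omega> = - ((- \<Omega>) \<times> (- \<Omega>))"

definition energy :: "'a::euclidean_space set \<Rightarrow> ('a \<Rightarrow> 'a \<Rightarrow> real) \<Rightarrow> ('a \<Rightarrow> real) \<Rightarrow> ennreal" where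
  "energy \<Omega> J u = ennreal (1/2) *
     (\<integral>\<^sup>+ p. indicator (Q_set \<Omega>) p * ennreal ((u (fst p) - u (snd p))\<^sup>2 * J (fst p) (snd p)) \<partial>lebesgue)"

definition L2_part :: "'a::euclidean_space set \<Rightarrow> ('a \<Rightarrow> real) \<Rightarrow> ennreal" where
  "L2_part \<Omega> u = (\<integral>\<^sup>+ x \<in> \<Omega>. ennreal ((u x)\<^sup>2) \<partial>lebesgue)"

definition HJ :: "'a::euclidean_space set \<Rightarrow> ('a \<Rightarrow> 'a \<Rightarrow> real) \<Rightarrow> ('a \<Rightarrow> real) set" where
  "HJ \<Omega> J = {u. u \<in> borel_measurable lebesgue \<and> L2_part \<Omega> u < \<infinity> \<and> energy \<Omega> J u < \<infinity>}"

definition HJ0 :: "'a::euclidean_space set \<Rightarrow> ('a \<Rightarrow> 'a \<Rightarrow> real) \<Rightarrow> ('a \<Rightarrow> real) set" where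
  "HJ0 \<Omega> J = {u \<in> HJ \<Omega> J. AE x in lebesgue. x \<notin> \<Omega> \<longrightarrow> u x = 0}"

definition HJ_norm :: "'a::euclidean_space set \<Rightarrow> ('a \<Rightarrow> 'a \<Rightarrow> real) \<Rightarrow> ('a \<Rightarrow> real) \<Rightarrow> real" where
  "HJ_norm \<Omega> J u = sqrt (enn2real (L2_part \<Omega> u + energy \<Omega> J u))"

definition H0 :: "('a::euclidean_space \<Rightarrow> 'a \<Rightarrow> real) \<Rightarrow> bool" where
  "H0 J \<longleftrightarrow> (\<lambda>p. J (fst p) (snd p)) \<in> borel_measurable lebesgue \<and>
     (\<forall>x y. J x y \<ge> 0) \<and> (\<forall>x y. J x y = J y x) \<and>
     (\<exists>C::real. \<forall>x. (\<integral>\<^sup>+ y. ennreal (min 1 ((norm (x - y))\<^sup>2) * J x y) \<partial>lebesgue) \<le> ennreal C)"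

definition H0' :: "('a::euclidean_space \<Rightarrow> 'a \<Rightarrow> real) \<Rightarrow> ('a \<Rightarrow> real) \<Rightarrow> bool" where
  "H0' J K \<longleftrightarrow> K \<in> borel_measurable lebesgue \<and> (\<forall>z. K z \<ge> 0) \<and>
     (\<forall>x y. J x y \<ge> K (x - y)) \<and>
     (\<forall>\<epsilon>>0. \<not> integrable lebesgue (\<lambda>z. indicator (ball 0 \<epsilon>) z * K z))"

definition H1 :: "('a::euclidean_space \<Rightarrow> real) \<Rightarrow> real \<Rightarrow> (real \<Rightarrow> real) \<Rightarrow> bool" where
  "H1 K \<rho> l \<longleftrightarrow> \<rho> > 0 \<and> (\<forall>s\<in>{0<..<\<rho>}. l s > 0) \<and>
     (\<forall>\<epsilon>\<in>{0<..<\<rho>}. \<exists>c1 c2. c1 > 0 \<and> c2 > 0 \<and> (\<forall>s\<in>{\<epsilon>..<\<rho>}. c1 \<le> l s \<and> l s \<le> c2)) \<and>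
     (\<forall>z. 0 < norm z \<and> norm z < \<rho> \<longrightarrow> K z = l (norm z) / norm z ^ DIM('a)) \<and>
     ((\<lambda>r. \<integral>\<^sup>+ s \<in> {r..\<rho>}. ennreal (l s / s) \<partial>lborel) \<longlongrightarrow> \<infinity>) (at_right 0)"

definition H2 :: "(real \<Rightarrow> real) \<Rightarrow> bool" where
  "H2 l \<longleftrightarrow> (\<forall>lam>0. ((\<lambda>s. l (lam * s) / l s) \<longlongrightarrow> 1) (at_right 0))"

end

theory Submission
  imports Defs "HOL-Library.Diagonal_Subsequence"
begin

text \<open>
  Truncating \<open>K\<close> gives bounded kernels \<open>k \<le> K\<close> supported in the unit ball whose mass \<open>\<kappa> = \<integral>k\<close> is as
  large as we like, because \<open>K\<close> is not integrable near the origin. Cauchy-Schwarz bounds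
  \<open>\<parallel>\<kappa> w - k * w\<parallel>\<^sup>2\<close> by \<open>\<kappa>\<close> times the energy of \<open>w\<close> with respect to \<open>k\<close>, so for functions of bounded
  energy \<open>\<parallel>w\<parallel>\<^sup>2 \<le> O(1/\<kappa>) + (2/\<kappa>\<^sup>2) \<parallel>k * w\<parallel>\<^sup>2\<close>, the last norm being taken over \<open>\<Omega>\<close>. Along a
  subsequence \<open>u\<close> that converges weakly in \<open>L\<^sup>2\<close>, every \<open>k * u n\<close> converges pointwise and boundedly, hence in
  \<open>L\<^sup>2(\<Omega>)\<close>; applied to \<open>w = u m - u n\<close> this makes \<open>u\<close> a Cauchy sequence.
  Weak convergence is only used as convergence of the numbers \<open>\<integral>u n * g\<close>; no weak limit is constructed.
\<close>

section \<open>Square-integrable functions\<close>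

lemma two_times_ennreal: "2 * ennreal x = ennreal (2 * x)"
  by (subst ennreal_mult') simp_all

text \<open>Bolzano-Weierstrass refines any subsequence so that one further row converges, and
  Cantor's diagonal serves all rows at once. It is used to make countably many pairings converge
  simultaneously.\<close>

lemma bounded_rows_diagonal_subsequence:
  fixes a :: "nat \<Rightarrow> nat \<Rightarrow> 'b::heine_borel"
  assumes "\<And>j. bounded (range (a j))"
  obtains r where "strict_mono r" "\<And>j. convergent (\<lambda>n. a j (r n))"
proof -
  define P where "P \<equiv> \<lambda>j s. convergent (\<lambda>n. a j (s n))"
  interpret subseqs P
  proof
    fix j and s :: "nat \<Rightarrow> nat" assume "strict_mono s"
    have "bounded (range (\<lambda>n. a j (s n)))"
      by (rule bounded_subset[OF assms[of j]]) auto
    from bounded_imp_convergent_subsequence[OF this]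
    obtain l r where "strict_mono r" "((\<lambda>n. a j (s n)) \<circ> r) \<longlonglongrightarrow> l"
      by blast
    then show "\<exists>r'. strict_mono r' \<and> P j (s \<circ> r')"
      unfolding P_def convergent_def by (auto simp: o_def)
  qed
  have "convergent (\<lambda>n. a j (diagseq n))" for j
  proof -
    \<comment> \<open>The diagonal sequence refines the stage that settles row \<open>j\<close> only
      after its first \<open>Suc j\<close> terms are dropped; convergence does not see these
      terms.\<close>
    have "P j (diagseq \<circ> ((+) (Suc j)))"
    proof (rule diagseq_holds)
      fix r s :: "nat \<Rightarrow> nat" and n
      assume "strict_mono r" "P n s"
      then show "P n (s \<circ> r)"
        unfolding P_def o_def using convergent_subseq_convergent[of "\<lambda>k. a n (s k)" r] by (simp add: o_def)
    qed
    then have "convergent (\<lambda>n. a j (diagseq (n + Suc j)))"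
      by (simp add: P_def o_def add.commute)
    then show ?thesis
      using convergent_ignore_initial_segment[of "\<lambda>n. a j (diagseq n)" "Suc j"] by simp
  qed
  with subseq_diagseq show ?thesis using that by blast
qed

text \<open>Integrability of the product comes first, from |fg| <= f^2 + g^2. This allows the
  Bochner integral of |fg| to be rewritten as a nonnegative integral, to which the
  \<open>ennreal\<close> version of Cauchy-Schwarz applies.\<close>

lemma L2_Cauchy_Schwarz:
  fixes f g :: "'a \<Rightarrow> real"
  assumes [measurable]: "f \<in> borel_measurable M" "g \<in> borel_measurable M"
    and f: "integrable M (\<lambda>x. (f x)\<^sup>2)" and g: "integrable M (\<lambda>x. (g x)\<^sup>2)"
  shows L2_times_integrable: "integrable M (\<lambda>x. f x * g x)"
    and L2_integral_mult_le: "(\<integral>x. f x * g x \<partial>M)\<^sup>2 \<le> (\<integral>x. (f x)\<^sup>2 \<partial>M) * (\<integral>x. (g x)\<^sup>2 \<partial>M)"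
proof -
  show fg: "integrable M (\<lambda>x. f x * g x)"
  proof (rule Bochner_Integration.integrable_bound)
    show "integrable M (\<lambda>x. (f x)\<^sup>2 + (g x)\<^sup>2)" using f g by simp
    have "\<bar>f x * g x\<bar> \<le> (f x)\<^sup>2 + (g x)\<^sup>2" for x
    proof -
      have "2 * (\<bar>f x\<bar> * \<bar>g x\<bar>) \<le> (f x)\<^sup>2 + (g x)\<^sup>2"
        using sum_squares_bound[of "\<bar>f x\<bar>" "\<bar>g x\<bar>"] by (simp add: mult.assoc)
      moreover have "0 \<le> \<bar>f x\<bar> * \<bar>g x\<bar>" by simp
      ultimately show ?thesis unfolding abs_mult by linarith
    qed
    then show "AE x in M. norm (f x * g x) \<le> norm ((f x)\<^sup>2 + (g x)\<^sup>2)"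
      by simp
  qed measurable
  have "ennreal (\<integral>x. \<bar>f x * g x\<bar> \<partial>M) = (\<integral>\<^sup>+x. ennreal \<bar>f x\<bar> * ennreal \<bar>g x\<bar> \<partial>M)"
    using integrable_abs[OF fg]
    by (subst nn_integral_eq_integral[symmetric]) (auto simp: abs_mult ennreal_mult)
  then have "ennreal ((\<integral>x. \<bar>f x * g x\<bar> \<partial>M)\<^sup>2) = (\<integral>\<^sup>+x. ennreal \<bar>f x\<bar> * ennreal \<bar>g x\<bar> \<partial>M)\<^sup>2"
    by (simp add: ennreal_power[symmetric])
  also have "\<dots> \<le> (\<integral>\<^sup>+x. ennreal \<bar>f x\<bar> ^ 2 \<partial>M) * (\<integral>\<^sup>+x. ennreal \<bar>g x\<bar> ^ 2 \<partial>M)"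
    by (rule Cauchy_Schwarz_nn_integral) measurable
  also have "\<dots> = ennreal ((\<integral>x. (f x)\<^sup>2 \<partial>M) * (\<integral>x. (g x)\<^sup>2 \<partial>M))"
    using f g by (simp add: ennreal_power nn_integral_eq_integral ennreal_mult)
  finally have "(\<integral>x. \<bar>f x * g x\<bar> \<partial>M)\<^sup>2 \<le> (\<integral>x. (f x)\<^sup>2 \<partial>M) * (\<integral>x. (g x)\<^sup>2 \<partial>M)"
    by (simp add: ennreal_le_iff)
  moreover have "(\<integral>x. f x * g x \<partial>M)\<^sup>2 \<le> (\<integral>x. \<bar>f x * g x\<bar> \<partial>M)\<^sup>2"
    by (rule abs_le_square_iff[THEN iffD1]) (simp add: integral_abs_bound)
  ultimately show "(\<integral>x. f x * g x \<partial>M)\<^sup>2 \<le> (\<integral>x. (f x)\<^sup>2 \<partial>M) * (\<integral>x. (g x)\<^sup>2 \<partial>M)"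
    by linarith
qed

lemma square_diff_le: "(a - b :: real)\<^sup>2 \<le> 2 * a\<^sup>2 + 2 * b\<^sup>2"
  using zero_le_power2[of "a + b"] by (simp add: power2_eq_square algebra_simps)

lemma square_integrable_diff:
  fixes f g :: "'a \<Rightarrow> real"
  assumes [measurable]: "f \<in> borel_measurable M" "g \<in> borel_measurable M"
    and f: "integrable M (\<lambda>x. (f x)\<^sup>2)" and g: "integrable M (\<lambda>x. (g x)\<^sup>2)"
  shows "integrable M (\<lambda>x. (f x - g x)\<^sup>2)"
proof (rule Bochner_Integration.integrable_bound)
  show "integrable M (\<lambda>x. 2 * (f x)\<^sup>2 + 2 * (g x)\<^sup>2)" using f g by simp
  show "AE x in M. norm ((f x - g x)\<^sup>2) \<le> norm (2 * (f x)\<^sup>2 + 2 * (g x)\<^sup>2)"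
    by (simp add: square_diff_le)
qed measurable

lemma square_integrable_bound:
  fixes f g :: "'a \<Rightarrow> real"
  assumes "integrable M (\<lambda>x. (g x)\<^sup>2)" "f \<in> borel_measurable M"
    "\<And>x. x \<in> space M \<Longrightarrow> \<bar>f x\<bar> \<le> \<bar>g x\<bar>"
  shows "integrable M (\<lambda>x. (f x)\<^sup>2)"
proof (rule Bochner_Integration.integrable_bound[OF assms(1)])
  show "(\<lambda>x. (f x)\<^sup>2) \<in> borel_measurable M" using assms(2) by simp
  show "AE x in M. norm ((f x)\<^sup>2) \<le> norm ((g x)\<^sup>2)"
    by (rule AE_I2) (use assms(3) in \<open>simp add: abs_le_square_iff\<close>)
qed

section \<open>Convergence of pairings with an L2-bounded sequence\<close>

text \<open>A three-epsilon argument: by Cauchy-Schwarz, exchanging \<open>g\<close> for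
  \<open>h\<close> moves every pairing by at most sqrt(C) times the L2 distance of \<open>g\<close>
  and \<open>h\<close>, uniformly in \<open>n\<close>. Hence the test functions with convergent
  pairings form an L2-closed class.\<close>

lemma L2_pairing_convergent_approx:
  fixes u :: "nat \<Rightarrow> 'a \<Rightarrow> real"
  assumes u [measurable]: "\<And>n. u n \<in> borel_measurable M"
    and u2: "\<And>n. integrable M (\<lambda>x. (u n x)\<^sup>2)" and C: "\<And>n. (\<integral>x. (u n x)\<^sup>2 \<partial>M) \<le> C"
    and g [measurable]: "g \<in> borel_measurable M" and g2: "integrable M (\<lambda>x. (g x)\<^sup>2)"
    and approx: "\<And>e. e > 0 \<Longrightarrow> \<exists>h \<in> borel_measurable M. integrable M (\<lambda>x. (h x)\<^sup>2) \<and>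
        (\<integral>x. (g x - h x)\<^sup>2 \<partial>M) < e \<and> convergent (\<lambda>n. \<integral>x. u n x * h x \<partial>M)"
  shows "convergent (\<lambda>n. \<integral>x. u n x * g x \<partial>M)"
proof -
  have C0: "C \<ge> 0" by (rule order_trans[OF _ C[of 0]]) simp
  let ?L = "\<lambda>n g. \<integral>x. u n x * g x \<partial>M"
  have "Cauchy (\<lambda>n. ?L n g)"
  proof (rule metric_CauchyI)
    fix e :: real assume e: "e > 0"
    \<comment> \<open>Dividing by \<open>C + 1\<close> instead of \<open>C\<close> covers
      \<open>C = 0\<close> and leaves a strict inequality after multiplication by
      \<open>C\<close>.\<close>
    then have "(e/3)\<^sup>2 / (C + 1) > 0" using C0 by simp
    from approx[OF this] obtain h where h[measurable]: "h \<in> borel_measurable M"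
      and h2: "integrable M (\<lambda>x. (h x)\<^sup>2)" and gh: "(\<integral>x. (g x - h x)\<^sup>2 \<partial>M) < (e/3)\<^sup>2 / (C + 1)"
      and conv: "convergent (\<lambda>n. ?L n h)" by blast
    from conv have "Cauchy (\<lambda>n. ?L n h)" by (simp add: Cauchy_convergent_iff)
    then obtain N where N: "\<And>m n. m \<ge> N \<Longrightarrow> n \<ge> N \<Longrightarrow> dist (?L m h) (?L n h) < e/3"
      using e unfolding Cauchy_def by (meson divide_pos_pos zero_less_numeral)
    have close: "\<bar>?L n g - ?L n h\<bar> < e/3" for n
    proof -
      have gh2: "integrable M (\<lambda>x. (g x - h x)\<^sup>2)"
        by (rule square_integrable_diff) (auto simp: g2 h2)
      have "?L n g - ?L n h = (\<integral>x. u n x * (g x - h x) \<partial>M)"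
        using L2_times_integrable[OF u g u2 g2] L2_times_integrable[OF u h u2 h2]
        by (simp add: right_diff_distrib)
      then have "(?L n g - ?L n h)\<^sup>2 \<le> (\<integral>x. (u n x)\<^sup>2 \<partial>M) * (\<integral>x. (g x - h x)\<^sup>2 \<partial>M)"
        using L2_integral_mult_le[OF u _ u2 gh2] by simp
      also have "\<dots> \<le> C * ((e/3)\<^sup>2 / (C + 1))"
        using C[of n] gh C0 by (intro mult_mono) auto
      also have "\<dots> < (e/3)\<^sup>2"
        using C0 e by (simp add: field_simps)
      finally have "\<bar>?L n g - ?L n h\<bar>\<^sup>2 < (e/3)\<^sup>2" by (simp only: power2_abs)
      from power2_less_imp_less[OF this] show ?thesis using e by simp
    qed
    have "dist (?L m g) (?L n g) < e" if "m \<ge> N" "n \<ge> N" for m n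
      using N[OF that] close[of m] close[of n] unfolding dist_real_def abs_less_iff by linarith
    then show "\<exists>N. \<forall>m\<ge>N. \<forall>n\<ge>N. dist (?L m g) (?L n g) < e" by blast
  qed
  then show ?thesis by (simp add: Cauchy_convergent_iff)
qed

text \<open>Since |U i| <= |g|, the squared distance of \<open>U i\<close> and \<open>g\<close> is
  at most 4 g^2, so dominated convergence upgrades pointwise to L2 convergence and the closedness
  just proved applies.\<close>

lemma L2_pairing_convergent_dominated:
  fixes u U :: "nat \<Rightarrow> 'a \<Rightarrow> real"
  assumes u [measurable]: "\<And>n. u n \<in> borel_measurable M"
    and u2: "\<And>n. integrable M (\<lambda>x. (u n x)\<^sup>2)" and C: "\<And>n. (\<integral>x. (u n x)\<^sup>2 \<partial>M) \<le> C"
    and g [measurable]: "g \<in> borel_measurable M" and g2: "integrable M (\<lambda>x. (g x)\<^sup>2)"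
    and U [measurable]: "\<And>i. U i \<in> borel_measurable M"
    and Ug: "\<And>i x. x \<in> space M \<Longrightarrow> \<bar>U i x\<bar> \<le> \<bar>g x\<bar>"
    and lim: "\<And>x. x \<in> space M \<Longrightarrow> (\<lambda>i. U i x) \<longlonglongrightarrow> g x"
    and conv: "\<And>i. convergent (\<lambda>n. \<integral>x. u n x * U i x \<partial>M)"
  shows "convergent (\<lambda>n. \<integral>x. u n x * g x \<partial>M)"
proof (rule L2_pairing_convergent_approx[OF u u2 C g g2])
  fix e :: real assume e: "e > 0"
  have U2: "integrable M (\<lambda>x. (U i x)\<^sup>2)" for i
    by (rule square_integrable_bound[OF g2]) (auto simp: Ug)
  have "(\<lambda>i. \<integral>x. (g x - U i x)\<^sup>2 \<partial>M) \<longlonglongrightarrow> (\<integral>x. 0 \<partial>M)"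
  proof (rule integral_dominated_convergence)
    show "integrable M (\<lambda>x. 4 * (g x)\<^sup>2)" using g2 by simp
    show "AE x in M. (\<lambda>i. (g x - U i x)\<^sup>2) \<longlonglongrightarrow> 0"
    proof (rule AE_I2)
      fix x assume "x \<in> space M"
      then have "(\<lambda>i. (g x - U i x)\<^sup>2) \<longlonglongrightarrow> (g x - g x)\<^sup>2"
        by (intro tendsto_intros lim)
      then show "(\<lambda>i. (g x - U i x)\<^sup>2) \<longlonglongrightarrow> 0" by simp
    qed
    have "(g x - U i x)\<^sup>2 \<le> 4 * (g x)\<^sup>2" if "x \<in> space M" for i x
      using square_diff_le[of "g x" "U i x"] Ug[OF that, of i] by (simp add: abs_le_square_iff)
    then show "AE x in M. norm ((g x - U i x)\<^sup>2) \<le> 4 * (g x)\<^sup>2" for i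
      by (intro AE_I2) auto
  qed measurable
  then have "\<forall>\<^sub>F i in sequentially. (\<integral>x. (g x - U i x)\<^sup>2 \<partial>M) < e"
    using e by (simp add: order_tendstoD(2))
  then obtain i where "(\<integral>x. (g x - U i x)\<^sup>2 \<partial>M) < e"
    by (meson eventually_sequentially le_refl)
  then show "\<exists>h\<in>borel_measurable M. integrable M (\<lambda>x. (h x)\<^sup>2) \<and>
      (\<integral>x. (g x - h x)\<^sup>2 \<partial>M) < e \<and> convergent (\<lambda>n. \<integral>x. u n x * h x \<partial>M)"
    using U2 conv U by blast
qed

section \<open>Completeness of L2\<close>

lemma ennreal_tendsto_0I:
  fixes F :: "'a \<Rightarrow> ennreal"
  assumes "\<And>e::real. e > 0 \<Longrightarrow> \<forall>\<^sub>F x in A. F x \<le> ennreal e"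
  shows "(F \<longlongrightarrow> 0) A"
proof (rule order_tendstoI)
  fix a :: ennreal assume "0 < a"
  then obtain b where b: "0 < b" "b < a" using dense by blast
  then obtain e where e: "b = ennreal e" "e > 0"
    by (cases b rule: ennreal_cases) auto
  from assms[OF e(2)] show "\<forall>\<^sub>F x in A. F x < a"
    by (rule eventually_mono) (use b e in auto)
qed simp

text \<open>The Riesz-Fischer argument: a rapidly Cauchy subsequence converges almost everywhere,
  and Fatou's lemma shows that the whole sequence approaches its limit. Only differences are
  measured, as \<open>ennreal\<close> integrals, so no single \<open>u n\<close> has to be square
  integrable.\<close>

lemma L2_complete:
  fixes u :: "nat \<Rightarrow> 'a \<Rightarrow> real"
  assumes u [measurable]: "\<And>n. u n \<in> borel_measurable M"
    and cauchy: "\<And>e::real. e > 0 \<Longrightarrow>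
      \<exists>N. \<forall>m\<ge>N. \<forall>n\<ge>N. (\<integral>\<^sup>+x. ennreal ((u m x - u n x)\<^sup>2) \<partial>M) \<le> ennreal e"
  obtains v where "v \<in> borel_measurable M" "(\<lambda>n. \<integral>\<^sup>+x. ennreal ((u n x - v x)\<^sup>2) \<partial>M) \<longlonglongrightarrow> 0"
proof -
  let ?d = "\<lambda>m n. \<integral>\<^sup>+x. ennreal ((u m x - u n x)\<^sup>2) \<partial>M"
  \<comment> \<open>The rate (1/4)^j absorbs the weight 2^j put on the squared increments below and
    still leaves the geometric series of (1/2)^j.\<close>
  have "\<exists>r. \<forall>j. (\<forall>m\<ge>r j. \<forall>n\<ge>r j. ?d m n \<le> ennreal ((1/4)^j)) \<and> r j < r (Suc j)"
  proof (rule dependent_nat_choice)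
    show "\<exists>N. \<forall>m\<ge>N. \<forall>n\<ge>N. ?d m n \<le> ennreal ((1/4)^0)"
      using cauchy[of 1] by simp
    fix N0 j
    obtain N where "\<forall>m\<ge>N. \<forall>n\<ge>N. ?d m n \<le> ennreal ((1/4)^Suc j)"
      using cauchy[of "(1/4)^Suc j"] by auto
    then show "\<exists>N. (\<forall>m\<ge>N. \<forall>n\<ge>N. ?d m n \<le> ennreal ((1/4)^Suc j)) \<and> N0 < N"
      by (intro exI[of _ "max N (Suc N0)"]) auto
  qed
  then obtain r where r: "\<And>j m n. m \<ge> r j \<Longrightarrow> n \<ge> r j \<Longrightarrow> ?d m n \<le> ennreal ((1/4)^j)"
    and rS: "\<And>j. r j < r (Suc j)" by blast
  have mono: "strict_mono r" using rS by (simp add: strict_mono_Suc_iff)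
  let ?D = "\<lambda>j x. u (r (Suc j)) x - u (r j) x"
  have "(\<integral>\<^sup>+x. (\<Sum>j. ennreal (2^j * (?D j x)\<^sup>2)) \<partial>M) = (\<Sum>j. \<integral>\<^sup>+x. ennreal (2^j * (?D j x)\<^sup>2) \<partial>M)"
    by (rule nn_integral_suminf) measurable
  also have "\<dots> \<le> (\<Sum>j. ennreal ((1/2)^j))"
  proof (rule suminf_le)
    fix j
    have "(\<integral>\<^sup>+x. ennreal (2^j * (?D j x)\<^sup>2) \<partial>M) = ennreal (2^j) * ?d (r (Suc j)) (r j)"
      by (simp add: ennreal_mult nn_integral_cmult)
    also have "\<dots> \<le> ennreal (2^j) * ennreal ((1/4)^j)"
      using rS[of j] by (intro mult_left_mono r) auto
    also have "\<dots> = ennreal ((1/2)^j)"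
      by (simp add: ennreal_mult[symmetric] power_mult_distrib[symmetric])
    finally show "(\<integral>\<^sup>+x. ennreal (2^j * (?D j x)\<^sup>2) \<partial>M) \<le> ennreal ((1/2)^j)" .
  qed auto
  also have "\<dots> < \<infinity>"
    by (subst suminf_ennreal2) (auto intro: summable_geometric)
  finally have "(\<integral>\<^sup>+x. (\<Sum>j. ennreal (2^j * (?D j x)\<^sup>2)) \<partial>M) \<noteq> \<infinity>" by simp
  then have "AE x in M. (\<Sum>j. ennreal (2^j * (?D j x)\<^sup>2)) \<noteq> \<infinity>"
    by (intro nn_integral_PInf_AE) auto
  then have conv: "AE x in M. convergent (\<lambda>j. u (r j) x)"
  proof eventually_elim
    fix x assume "(\<Sum>j. ennreal (2^j * (?D j x)\<^sup>2)) \<noteq> \<infinity>"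
    then have "summable (\<lambda>j. 2^j * (?D j x)\<^sup>2)"
      by (intro summable_suminf_not_top) auto
    then have s: "summable (\<lambda>j. (1/2)^j + 2^j * (?D j x)\<^sup>2)"
      by (intro summable_add) (auto intro: summable_geometric)
    have "summable (\<lambda>j. ?D j x)"
    proof (rule summable_comparison_test'[OF s])
      fix j
      \<comment> \<open>the weight \<open>2 ^ j\<close> makes \<open>2 * \<bar>d\<bar> \<le> 1 / 2 ^ j + 2 ^ j * d\<^sup>2\<close> summable in \<open>j\<close>\<close>
      define t d where "t = (2::real)^j" and "d = \<bar>?D j x\<bar>"
      have "t > 0" "d \<ge> 0" by (simp_all add: t_def d_def)
      then have "0 \<le> (1 - t * d)\<^sup>2 / t" by simp
      also have "(1 - t * d)\<^sup>2 / t = 1 / t + t * d\<^sup>2 - 2 * d"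
        using \<open>t > 0\<close> by (simp add: power2_eq_square field_simps)
      finally have "d \<le> 1 / t + t * d\<^sup>2" using \<open>d \<ge> 0\<close> by linarith
      then show "norm (?D j x) \<le> (1/2)^j + 2^j * (?D j x)\<^sup>2"
        by (simp add: t_def d_def power_divide)
    qed
    then have "convergent (\<lambda>n. \<Sum>j<n. ?D j x)" by (simp add: summable_iff_convergent)
    then have "convergent (\<lambda>n. u (r n) x - u (r 0) x)" by (simp add: sum_lessThan_telescope[of "\<lambda>j. u (r j) x"])
    from convergent_add[OF this convergent_const[of "u (r 0) x"]] show "convergent (\<lambda>j. u (r j) x)" by simp
  qed
  \<comment> \<open>On the null set where the subsequence diverges, \<open>lim\<close> is an
    unspecified value; measurability of \<open>v\<close> holds all the same.\<close>
  define v where "v x = lim (\<lambda>j. u (r j) x)" for x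
  have v[measurable]: "v \<in> borel_measurable M" unfolding v_def by (rule borel_measurable_lim_metric) measurable
  have "(\<lambda>n. \<integral>\<^sup>+x. ennreal ((u n x - v x)\<^sup>2) \<partial>M) \<longlonglongrightarrow> 0"
  proof (rule ennreal_tendsto_0I)
    fix e :: real assume "e > 0"
    from cauchy[OF this] obtain N
      where N: "\<And>m n. m \<ge> N \<Longrightarrow> n \<ge> N \<Longrightarrow> ?d m n \<le> ennreal e" by blast
    have "(\<integral>\<^sup>+x. ennreal ((u n x - v x)\<^sup>2) \<partial>M) \<le> ennreal e" if n: "n \<ge> N" for n
    proof -
      \<comment> \<open>With \<open>n\<close> fixed, the second index runs along the subsequence, so
        Fatou passes the Cauchy bound on to the limit \<open>v\<close>.\<close>
      have "AE x in M. ennreal ((u n x - v x)\<^sup>2) = liminf (\<lambda>j. ennreal ((u n x - u (r j) x)\<^sup>2))"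
        using conv
      proof eventually_elim
        fix x assume "convergent (\<lambda>j. u (r j) x)"
        then have "(\<lambda>j. u (r j) x) \<longlonglongrightarrow> v x"
          unfolding v_def by (simp add: convergent_LIMSEQ_iff)
        then have "(\<lambda>j. ennreal ((u n x - u (r j) x)\<^sup>2)) \<longlonglongrightarrow> ennreal ((u n x - v x)\<^sup>2)"
          by (intro tendsto_intros)
        then show "ennreal ((u n x - v x)\<^sup>2) = liminf (\<lambda>j. ennreal ((u n x - u (r j) x)\<^sup>2))"
          by (intro lim_imp_Liminf[symmetric]) auto
      qed
      then have "(\<integral>\<^sup>+x. ennreal ((u n x - v x)\<^sup>2) \<partial>M) =
          (\<integral>\<^sup>+x. liminf (\<lambda>j. ennreal ((u n x - u (r j) x)\<^sup>2)) \<partial>M)"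
        by (rule nn_integral_cong_AE)
      also have "\<dots> \<le> liminf (\<lambda>j. ?d n (r j))"
        by (rule nn_integral_liminf) measurable
      also have "\<dots> \<le> ennreal e"
      proof (rule Liminf_le)
        have "r j \<ge> N" if "j \<ge> N" for j
          using seq_suble[OF mono, of j] that by linarith
        then show "\<forall>\<^sub>F j in sequentially. ?d n (r j) \<le> ennreal e"
          using N[OF n] unfolding eventually_sequentially by blast
      qed simp
      finally show ?thesis .
    qed
    then show "\<forall>\<^sub>F n in sequentially. (\<integral>\<^sup>+x. ennreal ((u n x - v x)\<^sup>2) \<partial>M) \<le> ennreal e"
      unfolding eventually_sequentially by blast
  qed
  with v show ?thesis using that by blast
qed

section \<open>Weakly convergent subsequences in L2\<close>

text \<open>Diagonal extraction settles the indicators of countably many open sets. The two closure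
  lemmas for pairings then extend convergence to open sets, Borel sets, nonnegative functions and
  finally all square-integrable functions.\<close>

lemma L2_weak_subsequence:
  fixes u :: "nat \<Rightarrow> 'a::euclidean_space \<Rightarrow> real"
  assumes u [measurable]: "\<And>n. u n \<in> borel_measurable lborel"
    and u2: "\<And>n. integrable lborel (\<lambda>x. (u n x)\<^sup>2)"
    and C: "\<And>n. (\<integral>x. (u n x)\<^sup>2 \<partial>lborel) \<le> C"
  obtains r :: "nat \<Rightarrow> nat" where "strict_mono r"
    "\<And>g. g \<in> borel_measurable lborel \<Longrightarrow> integrable lborel (\<lambda>x. (g x)\<^sup>2) \<Longrightarrow>
       convergent (\<lambda>n. \<integral>x. u (r n) x * g x \<partial>lborel)"
proof -
  obtain B :: "'a set set" where B: "countable B" "topological_basis B"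
    using ex_countable_basis by blast
  \<comment> \<open>Finite unions of basic sets are still countably many, and every open set is an
    increasing union of them; the basic sets alone would not give such an exhaustion.\<close>
  define \<D> where "\<D> = {D. finite D \<and> D \<subseteq> B}"
  have cD: "countable \<D>" and D0: "\<D> \<noteq> {}"
    unfolding \<D>_def using countable_Collect_finite_subset[OF B(1)] by auto
  have open_D: "open (\<Union>D)" if "D \<subseteq> B" for D
    using topological_basis_open[OF B(2)] that by blast
  define F where "F j = \<Union>(from_nat_into \<D> j)" for j
  have F: "F j \<in> sets lborel" for j
    using open_D[of "from_nat_into \<D> j"] from_nat_into[OF D0, of j] unfolding F_def \<D>_def by auto
  have ind2: "integrable lborel (\<lambda>x. (indicator A x :: real)\<^sup>2)"
    if "A \<in> sets lborel" "emeasure lborel A < \<infinity>" for A :: "'a set"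
    using that by (simp add: power2_eq_square indicator_inter_arith[symmetric])
  \<comment> \<open>The value 0 is a placeholder on sets of infinite measure, where Cauchy-Schwarz
    gives no bound; it keeps every row bounded, as the extraction requires.\<close>
  define a where "a j n = (if emeasure lborel (F j) < \<infinity> then \<integral>x. u n x * indicator (F j) x \<partial>lborel else 0)"
    for j n
  have "bounded (range (a j))" for j
  proof (cases "emeasure lborel (F j) < \<infinity>")
    case True
    have "(a j n)\<^sup>2 \<le> C * (\<integral>x. (indicator (F j) x)\<^sup>2 \<partial>lborel)" for n
    proof -
      have "(a j n)\<^sup>2 \<le> (\<integral>x. (u n x)\<^sup>2 \<partial>lborel) * (\<integral>x. (indicator (F j) x)\<^sup>2 \<partial>lborel)"
        unfolding a_def using True L2_integral_mult_le[OF u _ u2 ind2[OF F True]] F by simp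
      also have "\<dots> \<le> C * (\<integral>x. (indicator (F j) x)\<^sup>2 \<partial>lborel)"
        by (intro mult_right_mono C) simp
      finally show ?thesis .
    qed
    then have "\<bar>a j n\<bar> \<le> sqrt (C * (\<integral>x. (indicator (F j) x)\<^sup>2 \<partial>lborel))" for n
      by (intro real_le_rsqrt) (simp only: power2_abs)
    then show ?thesis unfolding bounded_iff by (auto simp: real_norm_def)
  next
    case False
    then show ?thesis unfolding a_def bounded_iff by auto
  qed
  then obtain r where r: "strict_mono r" and conv_a: "\<And>j. convergent (\<lambda>n. a j (r n))"
    using bounded_rows_diagonal_subsequence[of a] by metis
  let ?conv = "\<lambda>g. convergent (\<lambda>n. \<integral>x. u (r n) x * g x \<partial>lborel)"
  note approx = L2_pairing_convergent_approx[of "\<lambda>n. u (r n)" lborel C, OF u u2 C]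
  note dominated = L2_pairing_convergent_dominated[of "\<lambda>n. u (r n)" lborel C, OF u u2 C]

  have conv_fin: "?conv (indicator (\<Union>D))"
    if D: "finite D" "D \<subseteq> B" and fin: "emeasure lborel (\<Union>D) < \<infinity>" for D
  proof -
    obtain j where j: "from_nat_into \<D> j = D"
      using from_nat_into_surj[OF cD, of D] D by (auto simp: \<D>_def)
    then show ?thesis using conv_a[of j] fin by (simp add: a_def F_def)
  qed

  have conv_open: "?conv (indicator T)" if T: "open T" "emeasure lborel T < \<infinity>" for T
  proof -
    from B(2) T(1) obtain B' where B': "B' \<subseteq> B" "\<Union>B' = T"
      unfolding topological_basis_def by blast
    show ?thesis
    \<comment> \<open>Enumerating \<open>B'\<close> by \<open>from_nat_into\<close> requires it to
      be nonempty.\<close>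
    proof (cases "B' = {}")
      case True
      then show ?thesis using conv_fin[of "{}"] B' by simp
    next
      case False
      define b where "b = from_nat_into B'"
      have rb: "range b = B'"
        unfolding b_def using False countable_subset[OF B'(1) B(1)] by (rule range_from_nat_into)
      have bT: "(\<Union>i<k. b i) \<subseteq> T" for k using rb B'(2) by blast
      have mT: "T \<in> sets lborel" using T(1) by simp
      show ?thesis
      proof (rule dominated[where U = "\<lambda>k. indicator (\<Union>i<k. b i)"])
        fix k
        have sub: "b ` {..<k} \<subseteq> B" using rb B'(1) by blast
        show m: "(indicator (\<Union>i<k. b i) :: 'a \<Rightarrow> real) \<in> borel_measurable lborel"
          using open_D[OF sub] by (intro borel_measurable_indicator) simp
        have "emeasure lborel (\<Union>i<k. b i) \<le> emeasure lborel T"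
          using bT mT by (rule emeasure_mono)
        then show "?conv (indicator (\<Union>i<k. b i))"
          using T(2) by (intro conv_fin sub) auto
        show "\<bar>indicator (\<Union>i<k. b i) x :: real\<bar> \<le> \<bar>indicator T x\<bar>" for x
          using bT[of k] by (auto simp: indicator_def)
      next
        fix x
        have "(\<lambda>k. indicator (\<Union>i<k. b i) x :: real) \<longlonglongrightarrow> indicator (\<Union>i. b i) x"
          by (rule LIMSEQ_indicator_UN)
        then show "(\<lambda>k. indicator (\<Union>i<k. b i) x :: real) \<longlonglongrightarrow> indicator T x"
          using rb B'(2) by simp
      qed (use mT T(2) ind2 in auto)
    qed
  qed

  \<comment> \<open>Outer regularity supplies an open \<open>T\<close> containing \<open>A\<close>;
    the squared L2 distance of the two indicators is the measure of \<open>T - A\<close>.\<close>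
  have conv_set: "?conv (indicator A)" if A: "A \<in> sets lborel" "emeasure lborel A < \<infinity>" for A
  proof (rule approx)
    show "indicator A \<in> borel_measurable lborel" using A by simp
    show "integrable lborel (\<lambda>x. (indicator A x :: real)\<^sup>2)" using A by (rule ind2)
    fix e :: real assume e: "e > 0"
    have "A \<in> sets lebesgue" using A(1) by auto
    then obtain T where T: "open T" "A \<subseteq> T" "emeasure lebesgue (T - A) < ennreal e"
      using e by (rule sets_lebesgue_outer_open)
    have mT: "T \<in> sets lborel" using T(1) by simp
    have TA: "emeasure lborel (T - A) < ennreal e" using T(3) mT A(1) by simp
    have "emeasure lborel T \<le> emeasure lborel A + emeasure lborel (T - A)"
      using emeasure_subadditive[of A lborel "T - A"] A(1) mT T(2) by (simp add: Un_absorb1)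
    also have "\<dots> < \<infinity>"
      using A(2) TA by (auto simp: less_top[symmetric] top_unique)
    finally have finT: "emeasure lborel T < \<infinity>" .
    have "(\<lambda>x. (indicator A x - indicator T x :: real)\<^sup>2) = indicator (T - A)"
      using T(2) by (intro ext) (auto simp: indicator_def)
    then have "(\<integral>x. (indicator A x - indicator T x :: real)\<^sup>2 \<partial>lborel) = measure lborel (T - A)"
      by simp
    also have "\<dots> < e"
      using TA e by (cases "emeasure lborel (T - A)" rule: ennreal_cases) (auto simp: measure_def ennreal_less_iff)
    finally have "(\<integral>x. (indicator A x - indicator T x :: real)\<^sup>2 \<partial>lborel) < e" .
    then show "\<exists>h\<in>borel_measurable lborel. integrable lborel (\<lambda>x. (h x)\<^sup>2) \<and>
        (\<integral>x. (indicator A x - h x :: real)\<^sup>2 \<partial>lborel) < e \<and> ?conv h"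
      using mT finT ind2 conv_open[OF T(1) finT] by (intro bexI[of _ "indicator T"]) auto
  qed

  \<comment> \<open>Square integrability is a premise inside the induction statement, because each
    case must pass it from the composite function to its constituents.\<close>
  have conv_nonneg: "integrable lborel (\<lambda>x. (g x)\<^sup>2) \<longrightarrow> ?conv g"
    if "g \<in> borel_measurable lborel" "\<And>x. 0 \<le> g x" for g
    using that
  proof (induction rule: borel_measurable_induct_real)
    case (set A)
    show ?case
    proof
      assume "integrable lborel (\<lambda>x. (indicator A x :: real)\<^sup>2)"
      moreover have "(\<lambda>x. (indicator A x :: real)\<^sup>2) = indicator A"
        by (intro ext) (simp add: indicator_def)
      ultimately have "integrable lborel (indicator A :: 'a \<Rightarrow> real)" by simp
      then show "?conv (indicator A)" using set by (intro conv_set) (auto simp: integrable_indicator_iff)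
    qed
  next
    case (mult g c)
    show ?case
    \<comment> \<open>For \<open>c = 0\<close> the square integrability of \<open>c * g\<close> says
      nothing about \<open>g\<close>, but then all pairings vanish.\<close>
    proof (cases "c = 0")
      case False
      show ?thesis
      proof
        assume "integrable lborel (\<lambda>x. (c * g x)\<^sup>2)"
        then have "?conv g" using mult False by (simp add: power_mult_distrib)
        then have "convergent (\<lambda>n. c * (\<integral>x. u (r n) x * g x \<partial>lborel))"
          using False by (simp add: convergent_mult_const_iff)
        then show "?conv (\<lambda>x. c * g x)"
          by (simp add: mult.left_commute[of _ c])
      qed
    qed (simp add: convergent_const)
  next
    case (add g h)
    show ?case
    proof
      assume gh: "integrable lborel (\<lambda>x. (h x + g x)\<^sup>2)"
      have gm: "g \<in> borel_measurable lborel" and hm: "h \<in> borel_measurable lborel"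
        using add by simp_all
      \<comment> \<open>Both summands are nonnegative, so each is dominated by their sum.\<close>
      have g2: "integrable lborel (\<lambda>x. (g x)\<^sup>2)" and h2: "integrable lborel (\<lambda>x. (h x)\<^sup>2)"
        by (rule square_integrable_bound[OF gh]; use add in \<open>auto simp: abs_of_nonneg\<close>)+
      have "convergent (\<lambda>n. (\<integral>x. u (r n) x * h x \<partial>lborel) + (\<integral>x. u (r n) x * g x \<partial>lborel))"
        using add g2 h2 by (intro convergent_add) auto
      then show "?conv (\<lambda>x. h x + g x)"
        using L2_times_integrable[OF u gm u2 g2] L2_times_integrable[OF u hm u2 h2]
        by (simp add: distrib_left)
    qed
  next
    case (seq U)
    show ?case
    proof
      assume g2: "integrable lborel (\<lambda>x. (g x)\<^sup>2)"
      have inc: "incseq U" and lim: "\<And>x. (\<lambda>i. U i x) \<longlonglongrightarrow> g x"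
        and U [measurable]: "\<And>i. U i \<in> borel_measurable lborel" and U0: "\<And>i x. 0 \<le> U i x"
        and IH: "\<And>i. integrable lborel (\<lambda>x. (U i x)\<^sup>2) \<Longrightarrow> ?conv (U i)"
        using seq by simp_all
      have "U i x \<le> g x" for i x
        using inc lim by (intro incseq_le[of "\<lambda>i. U i x"]) (auto simp: incseq_def le_fun_def)
      then have Ug: "\<bar>U i x\<bar> \<le> \<bar>g x\<bar>" for i x
        using U0[of i x] by (metis abs_ge_self abs_of_nonneg order_trans)
      have "integrable lborel (\<lambda>x. (U i x)\<^sup>2)" for i
        using U Ug by (intro square_integrable_bound[OF g2]) auto
      then have "?conv (U i)" for i by (rule IH)
      then show "?conv g"
        by (rule dominated[where U = U, OF that(1) g2 U Ug lim])
    qed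
  qed

  have "?conv g" if g[measurable]: "g \<in> borel_measurable lborel"
    and g2: "integrable lborel (\<lambda>x. (g x)\<^sup>2)" for g
  proof -
    have p2: "integrable lborel (\<lambda>x. (max 0 (g x))\<^sup>2)" and n2: "integrable lborel (\<lambda>x. (max 0 (- g x))\<^sup>2)"
      by (rule square_integrable_bound[OF g2]; auto)+
    have "convergent (\<lambda>n. (\<integral>x. u (r n) x * max 0 (g x) \<partial>lborel) - (\<integral>x. u (r n) x * max 0 (- g x) \<partial>lborel))"
      using conv_nonneg[of "\<lambda>x. max 0 (g x)"] conv_nonneg[of "\<lambda>x. max 0 (- g x)"] p2 n2
      by (intro convergent_diff) auto
    also have "(\<lambda>n. (\<integral>x. u (r n) x * max 0 (g x) \<partial>lborel) - (\<integral>x. u (r n) x * max 0 (- g x) \<partial>lborel)) =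
        (\<lambda>n. \<integral>x. u (r n) x * g x \<partial>lborel)"
    proof
      fix n
      have "u (r n) x * g x = u (r n) x * max 0 (g x) - u (r n) x * max 0 (- g x)" for x
        by (simp add: max_def)
      then show "(\<integral>x. u (r n) x * max 0 (g x) \<partial>lborel) - (\<integral>x. u (r n) x * max 0 (- g x) \<partial>lborel) =
          (\<integral>x. u (r n) x * g x \<partial>lborel)"
        using L2_times_integrable[OF u _ u2 p2] L2_times_integrable[OF u _ u2 n2] by simp
    qed
    finally show ?thesis .
  qed
  with r show ?thesis using that by blast
qed

section \<open>Nonlocal energies of integrable kernels\<close>

lemma nn_integral_lborel_reflect:
  fixes f :: "'a::euclidean_space \<Rightarrow> ennreal"
  assumes [measurable]: "f \<in> borel_measurable borel"
  shows "(\<integral>\<^sup>+y. f (x - y) \<partial>lborel) = (\<integral>\<^sup>+y. f y \<partial>lborel)"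
proof -
  have "(\<integral>\<^sup>+y. f y \<partial>lborel) =
      (\<integral>\<^sup>+y. f y \<partial>density (distr lborel borel (\<lambda>y. x + (-1) *\<^sub>R y)) (\<lambda>_. \<bar>-1::real\<bar> ^ DIM('a)))"
    by (subst lborel_affine[of "-1" x]) simp_all
  also have "\<dots> = (\<integral>\<^sup>+y. f (x - y) \<partial>lborel)"
    by (simp add: nn_integral_density nn_integral_distr)
  finally show ?thesis by simp
qed

lemma lborel_reflect_nonneg:
  fixes f :: "'a::euclidean_space \<Rightarrow> real"
  assumes f: "integrable lborel f" and nonneg: "\<And>z. 0 \<le> f z"
  shows integrable_lborel_reflect: "integrable lborel (\<lambda>y. f (x - y))"
    and integral_lborel_reflect: "(\<integral>y. f (x - y) \<partial>lborel) = (\<integral>y. f y \<partial>lborel)"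
proof -
  have [measurable]: "f \<in> borel_measurable borel"
    using borel_measurable_integrable[OF f] by simp
  have nn: "(\<integral>\<^sup>+y. ennreal (f (x - y)) \<partial>lborel) = ennreal (\<integral>y. f y \<partial>lborel)"
    using nn_integral_lborel_reflect[of "\<lambda>z. ennreal (f z)" x] f nonneg
    by (simp add: nn_integral_eq_integral)
  show "integrable lborel (\<lambda>y. f (x - y))"
    by (rule integrableI_nonneg) (use nonneg nn in auto)
  show "(\<integral>y. f (x - y) \<partial>lborel) = (\<integral>y. f y \<partial>lborel)"
    using nn nonneg by (simp add: integral_eq_nn_integral integral_nonneg)
qed

text \<open>The quadratic form of a translation-invariant kernel, over the whole product space and
  without the factor 1/2. The value in \<open>ennreal\<close> admits infinite energies, and the
  product of \<open>lborel\<close> measures gives direct access to Tonelli.\<close>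

definition nonlocal_energy :: "('a::euclidean_space \<Rightarrow> real) \<Rightarrow> ('a \<Rightarrow> real) \<Rightarrow> ennreal" where
  "nonlocal_energy k u =
     (\<integral>\<^sup>+p. ennreal (k (fst p - snd p) * (u (fst p) - u (snd p))\<^sup>2) \<partial>(lborel \<Otimes>\<^sub>M lborel))"

lemma nonlocal_energy_iterated:
  fixes u :: "'a::euclidean_space \<Rightarrow> real"
  assumes [measurable]: "k \<in> borel_measurable borel" "u \<in> borel_measurable borel"
  shows "nonlocal_energy k u = (\<integral>\<^sup>+x. \<integral>\<^sup>+y. ennreal (k (x - y) * (u x - u y)\<^sup>2) \<partial>lborel \<partial>lborel)"
  unfolding nonlocal_energy_def
  by (subst lborel.nn_integral_fst[symmetric]) (simp_all add: case_prod_beta)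

lemma nonlocal_energy_diff_le:
  fixes u v :: "'a::euclidean_space \<Rightarrow> real"
  assumes [measurable]: "k \<in> borel_measurable borel" "u \<in> borel_measurable borel" "v \<in> borel_measurable borel"
    and k: "\<And>z. 0 \<le> k z"
  shows "nonlocal_energy k (\<lambda>x. u x - v x) \<le> 2 * nonlocal_energy k u + 2 * nonlocal_energy k v"
proof -
  let ?M = "lborel \<Otimes>\<^sub>M lborel :: ('a \<times> 'a) measure"
  have "nonlocal_energy k (\<lambda>x. u x - v x) \<le>
     (\<integral>\<^sup>+p. (2 * ennreal (k (fst p - snd p) * (u (fst p) - u (snd p))\<^sup>2) +
           2 * ennreal (k (fst p - snd p) * (v (fst p) - v (snd p))\<^sup>2)) \<partial>?M)"
    unfolding nonlocal_energy_def
  proof (rule nn_integral_mono)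
    fix p :: "'a \<times> 'a"
    let ?k = "k (fst p - snd p)" and ?a = "u (fst p) - u (snd p)" and ?b = "v (fst p) - v (snd p)"
    have "?k * (u (fst p) - v (fst p) - (u (snd p) - v (snd p)))\<^sup>2 = ?k * (?a - ?b)\<^sup>2"
      by (simp add: algebra_simps)
    also have "\<dots> \<le> ?k * (2 * ?a\<^sup>2 + 2 * ?b\<^sup>2)"
      by (intro mult_left_mono square_diff_le k)
    also have "\<dots> = 2 * (?k * ?a\<^sup>2) + 2 * (?k * ?b\<^sup>2)"
      by (simp add: algebra_simps)
    finally have "ennreal (?k * (u (fst p) - v (fst p) - (u (snd p) - v (snd p)))\<^sup>2)
        \<le> ennreal (2 * (?k * ?a\<^sup>2) + 2 * (?k * ?b\<^sup>2))"
      by (rule ennreal_leI)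
    also have "\<dots> = 2 * ennreal (?k * ?a\<^sup>2) + 2 * ennreal (?k * ?b\<^sup>2)"
      using k[of "fst p - snd p"] by (simp add: ennreal_plus ennreal_mult)
    finally show "ennreal (?k * (u (fst p) - v (fst p) - (u (snd p) - v (snd p)))\<^sup>2)
        \<le> 2 * ennreal (?k * ?a\<^sup>2) + 2 * ennreal (?k * ?b\<^sup>2)" .
  qed
  also have "\<dots> = 2 * nonlocal_energy k u + 2 * nonlocal_energy k v"
    unfolding nonlocal_energy_def by (simp add: nn_integral_add nn_integral_cmult)
  finally show ?thesis .
qed

section \<open>Control of the L2 norm by energy and convolution\<close>

text \<open>With \<kappa> the mass of \<open>k\<close>, the difference \<kappa> w(x) - (k * w)(x) is
  the integral of k(x - y)(w(x) - w(y)) over y. Cauchy-Schwarz bounds its square by \<kappa> times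
  the energy density at \<open>x\<close>.\<close>

lemma nonlocal_pointwise_estimate:
  fixes w :: "'a::euclidean_space \<Rightarrow> real"
  assumes [measurable]: "k \<in> borel_measurable borel" "w \<in> borel_measurable borel"
    and k: "\<And>z. 0 \<le> k z" and k1: "integrable lborel k" and k2: "integrable lborel (\<lambda>z. (k z)\<^sup>2)"
    and w2: "integrable lborel (\<lambda>x. (w x)\<^sup>2)"
  shows "ennreal (((\<integral>z. k z \<partial>lborel) * w x)\<^sup>2) \<le>
    2 * ennreal (\<integral>z. k z \<partial>lborel) * (\<integral>\<^sup>+y. ennreal (k (x - y) * (w x - w y)\<^sup>2) \<partial>lborel) +
    2 * ennreal ((\<integral>y. w y * k (x - y) \<partial>lborel)\<^sup>2)"
proof -
  define \<kappa> where "\<kappa> = (\<integral>z. k z \<partial>lborel)"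
  define c where "c = (\<integral>y. w y * k (x - y) \<partial>lborel)"
  have \<kappa>: "\<kappa> \<ge> 0" unfolding \<kappa>_def using k by (simp add: integral_nonneg)
  have kx: "integrable lborel (\<lambda>y. k (x - y))" and kx_eq: "(\<integral>y. k (x - y) \<partial>lborel) = \<kappa>"
    unfolding \<kappa>_def using lborel_reflect_nonneg[OF k1 k] by auto
  have kx2: "integrable lborel (\<lambda>y. (k (x - y))\<^sup>2)"
    using integrable_lborel_reflect[OF k2] by simp
  have wk: "integrable lborel (\<lambda>y. w y * k (x - y))"
    by (rule L2_times_integrable) (use w2 kx2 in auto)
  have int: "integrable lborel (\<lambda>y. k (x - y) * (w x - w y))"
    using Bochner_Integration.integrable_diff[OF integrable_mult_right[OF kx, of "w x"] wk]
    by (simp add: algebra_simps)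
  have "(\<integral>y. k (x - y) * (w x - w y) \<partial>lborel) = \<kappa> * w x - c"
    using Bochner_Integration.integral_diff[OF integrable_mult_right[OF kx, of "w x"] wk] kx_eq
    by (simp add: algebra_simps c_def)
  then have "ennreal \<bar>\<kappa> * w x - c\<bar> \<le> (\<integral>\<^sup>+y. ennreal \<bar>k (x - y) * (w x - w y)\<bar> \<partial>lborel)"
    using integral_norm_bound_ennreal[OF int] by simp
  \<comment> \<open>Splitting \<open>k\<close> into two square roots leaves the mass \<kappa> in one
    factor and the energy density in the other.\<close>
  also have "\<dots> = (\<integral>\<^sup>+y. ennreal (sqrt (k (x - y))) * ennreal (sqrt (k (x - y)) * \<bar>w x - w y\<bar>) \<partial>lborel)"
    using k by (intro nn_integral_cong) (simp add: ennreal_mult[symmetric] abs_mult mult.assoc[symmetric])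
  finally have "(ennreal \<bar>\<kappa> * w x - c\<bar>)\<^sup>2 \<le> \<dots>\<^sup>2"
    by (rule power_mono) simp
  also have "\<dots> \<le> (\<integral>\<^sup>+y. ennreal (sqrt (k (x - y))) ^ 2 \<partial>lborel) *
      (\<integral>\<^sup>+y. ennreal (sqrt (k (x - y)) * \<bar>w x - w y\<bar>) ^ 2 \<partial>lborel)"
    by (rule Cauchy_Schwarz_nn_integral) measurable
  also have "(\<integral>\<^sup>+y. ennreal (sqrt (k (x - y))) ^ 2 \<partial>lborel) = ennreal \<kappa>"
    using k kx kx_eq by (simp add: ennreal_power nn_integral_eq_integral)
  also have "(\<integral>\<^sup>+y. ennreal (sqrt (k (x - y)) * \<bar>w x - w y\<bar>) ^ 2 \<partial>lborel) =
      (\<integral>\<^sup>+y. ennreal (k (x - y) * (w x - w y)\<^sup>2) \<partial>lborel)"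
    using k by (simp add: ennreal_power power_mult_distrib)
  finally have est: "ennreal ((\<kappa> * w x - c)\<^sup>2) \<le>
      ennreal \<kappa> * (\<integral>\<^sup>+y. ennreal (k (x - y) * (w x - w y)\<^sup>2) \<partial>lborel)"
    by (simp add: ennreal_power)
  have "(\<kappa> * w x)\<^sup>2 \<le> 2 * (\<kappa> * w x - c)\<^sup>2 + 2 * c\<^sup>2"
    using square_diff_le[of "\<kappa> * w x - c" "- c"] by simp
  then have "ennreal ((\<kappa> * w x)\<^sup>2) \<le> ennreal (2 * (\<kappa> * w x - c)\<^sup>2 + 2 * c\<^sup>2)"
    by (rule ennreal_leI)
  also have "\<dots> = 2 * ennreal ((\<kappa> * w x - c)\<^sup>2) + 2 * ennreal (c\<^sup>2)"
    by (simp add: ennreal_plus ennreal_mult)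
  also have "\<dots> \<le> 2 * (ennreal \<kappa> * (\<integral>\<^sup>+y. ennreal (k (x - y) * (w x - w y)\<^sup>2) \<partial>lborel)) + 2 * ennreal (c\<^sup>2)"
    by (intro add_right_mono mult_left_mono est) simp
  finally show ?thesis by (simp add: \<kappa>_def c_def mult.assoc)
qed

text \<open>The pointwise estimate is integrated over x. Outside \<Omega> the left side vanishes, so
  the convolution has to be measured only on \<Omega>, which later has finite measure.\<close>

lemma nonlocal_estimate:
  fixes w :: "'a::euclidean_space \<Rightarrow> real"
  assumes k_meas [measurable]: "k \<in> borel_measurable borel" and w_meas [measurable]: "w \<in> borel_measurable borel"
    and k: "\<And>z. 0 \<le> k z" and k1: "integrable lborel k" and k2: "integrable lborel (\<lambda>z. (k z)\<^sup>2)"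
    and w2: "integrable lborel (\<lambda>x. (w x)\<^sup>2)"
    and \<Omega> [measurable]: "\<Omega> \<in> sets borel" and supp: "\<And>x. x \<notin> \<Omega> \<Longrightarrow> w x = 0"
  shows "ennreal ((\<integral>z. k z \<partial>lborel)\<^sup>2) * (\<integral>\<^sup>+x. ennreal ((w x)\<^sup>2) \<partial>lborel) \<le>
    2 * ennreal (\<integral>z. k z \<partial>lborel) * nonlocal_energy k w +
    2 * (\<integral>\<^sup>+x. ennreal (indicator \<Omega> x * (\<integral>y. w y * k (x - y) \<partial>lborel)\<^sup>2) \<partial>lborel)"
proof -
  let ?c = "\<lambda>x. \<integral>y. w y * k (x - y) \<partial>lborel"
  let ?\<kappa> = "\<integral>z. k z \<partial>lborel"
  let ?I = "\<lambda>x. \<integral>\<^sup>+y. ennreal (k (x - y) * (w x - w y)\<^sup>2) \<partial>lborel"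
  have "ennreal (?\<kappa>\<^sup>2) * (\<integral>\<^sup>+x. ennreal ((w x)\<^sup>2) \<partial>lborel) = (\<integral>\<^sup>+x. ennreal ((?\<kappa> * w x)\<^sup>2) \<partial>lborel)"
    by (simp add: nn_integral_cmult[symmetric] ennreal_mult[symmetric] power_mult_distrib)
  also have "\<dots> \<le> (\<integral>\<^sup>+x. 2 * ennreal ?\<kappa> * ?I x + 2 * ennreal (indicator \<Omega> x * (?c x)\<^sup>2) \<partial>lborel)"
  proof (rule nn_integral_mono)
    fix x
    show "ennreal ((?\<kappa> * w x)\<^sup>2) \<le> 2 * ennreal ?\<kappa> * ?I x + 2 * ennreal (indicator \<Omega> x * (?c x)\<^sup>2)"
    proof (cases "x \<in> \<Omega>")
      case True
      then show ?thesis
        using nonlocal_pointwise_estimate[OF k_meas w_meas k k1 k2 w2, of x] by simp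
    qed (simp add: supp)
  qed
  also have "\<dots> = 2 * ennreal ?\<kappa> * (\<integral>\<^sup>+x. ?I x \<partial>lborel) +
      2 * (\<integral>\<^sup>+x. ennreal (indicator \<Omega> x * (?c x)\<^sup>2) \<partial>lborel)"
    by (simp add: nn_integral_add nn_integral_cmult)
  finally show ?thesis by (simp add: nonlocal_energy_iterated)
qed

text \<open>For fixed \<open>x\<close> the reflected translate k(x - y) is a square-integrable test
  function of y, so the convolutions converge at every point. They are uniformly bounded by
  Cauchy-Schwarz, and the finite measure of \<Omega> permits dominated convergence.\<close>

lemma convolution_Cauchy_on_finite_measure:
  fixes u :: "nat \<Rightarrow> 'a::euclidean_space \<Rightarrow> real"
  assumes u [measurable]: "\<And>n. u n \<in> borel_measurable borel"
    and u2: "\<And>n. integrable lborel (\<lambda>x. (u n x)\<^sup>2)" and C: "\<And>n. (\<integral>x. (u n x)\<^sup>2 \<partial>lborel) \<le> C"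
    and weak: "\<And>g. g \<in> borel_measurable borel \<Longrightarrow> integrable lborel (\<lambda>x. (g x)\<^sup>2) \<Longrightarrow>
       convergent (\<lambda>n. \<integral>x. u n x * g x \<partial>lborel)"
    and k [measurable]: "k \<in> borel_measurable borel" and k2: "integrable lborel (\<lambda>z. (k z)\<^sup>2)"
    and \<Omega> [measurable]: "\<Omega> \<in> sets borel" and fin: "emeasure lborel \<Omega> < \<infinity>" and e: "e > 0"
  shows "\<exists>N. \<forall>m\<ge>N. \<forall>n\<ge>N. (\<integral>\<^sup>+x. ennreal (indicator \<Omega> x *
    (\<integral>y. (u m y - u n y) * k (x - y) \<partial>lborel)\<^sup>2) \<partial>lborel) \<le> ennreal e"
proof -
  define c where "c n x = (\<integral>y. u n y * k (x - y) \<partial>lborel)" for n x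
  \<comment> \<open>The limit of the convolutions is taken point by point, so no weak limit of
    \<open>u\<close> is involved.\<close>
  define W where "W x = lim (\<lambda>n. c n x)" for x
  define D where "D = C * (\<integral>z. (k z)\<^sup>2 \<partial>lborel)"
  have c_meas [measurable]: "c n \<in> borel_measurable borel" for n
    unfolding c_def by measurable
  have W_meas [measurable]: "W \<in> borel_measurable borel"
    unfolding W_def by (rule borel_measurable_lim_metric) measurable
  have kx2: "integrable lborel (\<lambda>y. (k (x - y))\<^sup>2)"
    and kx2_eq: "(\<integral>y. (k (x - y))\<^sup>2 \<partial>lborel) = (\<integral>z. (k z)\<^sup>2 \<partial>lborel)" for x
    using lborel_reflect_nonneg[OF k2] by auto
  have lim: "(\<lambda>n. c n x) \<longlonglongrightarrow> W x" for x
    unfolding W_def c_def convergent_LIMSEQ_iff[symmetric] by (rule weak) (auto simp: kx2)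
  have c_bound: "(c n x)\<^sup>2 \<le> D" for n x
  proof -
    have "(c n x)\<^sup>2 \<le> (\<integral>y. (u n y)\<^sup>2 \<partial>lborel) * (\<integral>y. (k (x - y))\<^sup>2 \<partial>lborel)"
      unfolding c_def by (rule L2_integral_mult_le) (auto simp: u2 kx2)
    also have "\<dots> \<le> D"
      unfolding D_def kx2_eq by (intro mult_right_mono C) simp
    finally show ?thesis .
  qed
  have W_bound: "(W x)\<^sup>2 \<le> D" for x
    by (rule LIMSEQ_le_const2[OF tendsto_power[OF lim]]) (use c_bound in auto)
  have "(\<lambda>n. \<integral>\<^sup>+x. ennreal (indicator \<Omega> x * (c n x - W x)\<^sup>2) \<partial>lborel) \<longlonglongrightarrow> (\<integral>\<^sup>+(x::'a). 0 \<partial>lborel)"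
  proof (rule nn_integral_dominated_convergence)
    show "AE x in lborel. ennreal (indicator \<Omega> x * (c n x - W x)\<^sup>2) \<le> ennreal (4 * D) * indicator \<Omega> x" for n
    proof (rule AE_I2)
      fix x
      have "(c n x - W x)\<^sup>2 \<le> 4 * D"
        using square_diff_le[of "c n x" "W x"] c_bound[of n x] W_bound[of x] by linarith
      then show "ennreal (indicator \<Omega> x * (c n x - W x)\<^sup>2) \<le> ennreal (4 * D) * indicator \<Omega> x"
        by (auto simp: indicator_def intro!: ennreal_leI)
    qed
    show "(\<integral>\<^sup>+x. ennreal (4 * D) * indicator \<Omega> x \<partial>lborel) < \<infinity>"
      using fin by (simp add: nn_integral_cmult_indicator ennreal_mult_less_top)
    show "AE x in lborel. (\<lambda>n. ennreal (indicator \<Omega> x * (c n x - W x)\<^sup>2)) \<longlonglongrightarrow> 0"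
    proof (rule AE_I2)
      fix x
      have "(\<lambda>n. ennreal (indicator \<Omega> x * (c n x - W x)\<^sup>2)) \<longlonglongrightarrow> ennreal (indicator \<Omega> x * (W x - W x)\<^sup>2)"
        by (intro tendsto_intros lim)
      then show "(\<lambda>n. ennreal (indicator \<Omega> x * (c n x - W x)\<^sup>2)) \<longlonglongrightarrow> 0" by simp
    qed
  qed measurable
  \<comment> \<open>The share e/4 is due to (a - b)^2 <= 2 a^2 + 2 b^2, which gives 2(e/4) + 2(e/4)
    = e for two indices.\<close>
  then have "\<forall>\<^sub>F n in sequentially. (\<integral>\<^sup>+x. ennreal (indicator \<Omega> x * (c n x - W x)\<^sup>2) \<partial>lborel) < ennreal (e/4)"
    using e by (intro order_tendstoD(2)[where a = "ennreal (e/4)"]) auto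
  then obtain N where N: "\<And>n. n \<ge> N \<Longrightarrow>
      (\<integral>\<^sup>+x. ennreal (indicator \<Omega> x * (c n x - W x)\<^sup>2) \<partial>lborel) \<le> ennreal (e/4)"
    unfolding eventually_sequentially by (meson less_imp_le)
  have "(\<integral>\<^sup>+x. ennreal (indicator \<Omega> x * (\<integral>y. (u m y - u n y) * k (x - y) \<partial>lborel)\<^sup>2) \<partial>lborel) \<le> ennreal e"
    if m: "m \<ge> N" and n: "n \<ge> N" for m n
  proof -
    have diff: "(\<integral>y. (u m y - u n y) * k (x - y) \<partial>lborel) = c m x - c n x" for x
      using L2_times_integrable[OF _ _ u2 kx2] unfolding c_def left_diff_distrib
      by (intro Bochner_Integration.integral_diff) auto
    have "(\<integral>\<^sup>+x. ennreal (indicator \<Omega> x * (c m x - c n x)\<^sup>2) \<partial>lborel) \<le>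
        (\<integral>\<^sup>+x. 2 * ennreal (indicator \<Omega> x * (c m x - W x)\<^sup>2) + 2 * ennreal (indicator \<Omega> x * (c n x - W x)\<^sup>2) \<partial>lborel)"
    proof (rule nn_integral_mono)
      fix x
      have "indicator \<Omega> x * (c m x - c n x)\<^sup>2 \<le>
          2 * (indicator \<Omega> x * (c m x - W x)\<^sup>2) + 2 * (indicator \<Omega> x * (c n x - W x)\<^sup>2)"
        using square_diff_le[of "c m x - W x" "c n x - W x"] by (simp add: indicator_def)
      then show "ennreal (indicator \<Omega> x * (c m x - c n x)\<^sup>2) \<le>
          2 * ennreal (indicator \<Omega> x * (c m x - W x)\<^sup>2) + 2 * ennreal (indicator \<Omega> x * (c n x - W x)\<^sup>2)"
        by (subst (asm) ennreal_le_iff[symmetric]) (simp_all add: ennreal_plus ennreal_mult)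
    qed
    also have "\<dots> = 2 * (\<integral>\<^sup>+x. ennreal (indicator \<Omega> x * (c m x - W x)\<^sup>2) \<partial>lborel) +
        2 * (\<integral>\<^sup>+x. ennreal (indicator \<Omega> x * (c n x - W x)\<^sup>2) \<partial>lborel)"
      by (simp add: nn_integral_add nn_integral_cmult)
    also have "\<dots> \<le> 2 * ennreal (e/4) + 2 * ennreal (e/4)"
      by (intro add_mono mult_left_mono N m n) simp_all
    also have "\<dots> = ennreal (2 * (e/4) + 2 * (e/4))"
      using e unfolding two_times_ennreal by (intro ennreal_plus[symmetric]) auto
    finally show ?thesis unfolding diff by simp
  qed
  then show ?thesis by blast
qed

text \<open>The bound \<open>E\<close> is the same for all kernels, while their mass is arbitrarily
  large. A kernel heavy enough to make the energy term small is fixed first; only then is the index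
  chosen beyond which its convolutions are close.\<close>

lemma nonlocal_energy_compactness:
  fixes u :: "nat \<Rightarrow> 'a::euclidean_space \<Rightarrow> real"
  assumes u [measurable]: "\<And>n. u n \<in> borel_measurable borel"
    and u2: "\<And>n. integrable lborel (\<lambda>x. (u n x)\<^sup>2)" and C: "\<And>n. (\<integral>x. (u n x)\<^sup>2 \<partial>lborel) \<le> C"
    and \<Omega> [measurable]: "\<Omega> \<in> sets borel" and fin: "emeasure lborel \<Omega> < \<infinity>"
    and supp: "\<And>n x. x \<notin> \<Omega> \<Longrightarrow> u n x = 0"
    and kernels: "\<And>c::real. \<exists>k\<in>borel_measurable borel. (\<forall>z. 0 \<le> k z) \<and> integrable lborel k \<and>
      integrable lborel (\<lambda>z. (k z)\<^sup>2) \<and> c < (\<integral>z. k z \<partial>lborel) \<and> (\<forall>n. nonlocal_energy k (u n) \<le> ennreal E)"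
  obtains r v where "strict_mono r" "v \<in> borel_measurable borel"
    "(\<lambda>n. \<integral>\<^sup>+x. ennreal ((u (r n) x - v x)\<^sup>2) \<partial>lborel) \<longlonglongrightarrow> 0"
proof -
  have um: "u n \<in> borel_measurable lborel" for n by simp
  obtain r where r: "strict_mono r"
    and weak: "\<And>g. g \<in> borel_measurable lborel \<Longrightarrow> integrable lborel (\<lambda>x. (g x)\<^sup>2) \<Longrightarrow>
       convergent (\<lambda>n. \<integral>x. u (r n) x * g x \<partial>lborel)"
    by (rule L2_weak_subsequence[of u, OF um u2 C], rule that)
  have "\<exists>N. \<forall>m\<ge>N. \<forall>n\<ge>N. (\<integral>\<^sup>+x. ennreal ((u (r m) x - u (r n) x)\<^sup>2) \<partial>lborel) \<le> ennreal e"
    if e: "e > 0" for e :: real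
  proof -
    \<comment> \<open>No sign is assumed for \<open>E\<close>; \<open>ennreal\<close> sends negative
      numbers to 0, so the bound is unchanged.\<close>
    define E' where "E' = max 0 E"
    have ennE': "ennreal E = ennreal E'" by (simp add: E'_def max_def ennreal_neg)
    obtain k where k_meas [measurable]: "k \<in> borel_measurable borel" and k: "\<And>z. 0 \<le> k z"
      and k1: "integrable lborel k" and k2: "integrable lborel (\<lambda>z. (k z)\<^sup>2)"
      \<comment> \<open>A difference has energy at most 4E', contributing 2 \<kappa> (4E') = 8
        \<kappa> E'. Mass above 16E'/e makes this at most half of \<kappa>^2 e; the tolerance
        \<kappa>^2 e/4 for the doubled convolution term supplies the other half.\<close>
      and large: "16 * E' / e < (\<integral>z. k z \<partial>lborel)" and energy: "\<And>n. nonlocal_energy k (u n) \<le> ennreal E'"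
      using kernels[of "16 * E' / e"] unfolding ennE' by blast
    define \<kappa> where "\<kappa> = (\<integral>z. k z \<partial>lborel)"
    have E': "E' \<ge> 0" by (simp add: E'_def)
    then have "16 * E' / e \<ge> 0" using e by simp
    then have \<kappa>: "\<kappa> > 0" using large unfolding \<kappa>_def by linarith
    have E'\<kappa>: "16 * E' \<le> \<kappa> * e" using large e by (simp add: \<kappa>_def field_simps)
    let ?Y = "\<lambda>m n. \<integral>\<^sup>+x. ennreal (indicator \<Omega> x *
        (\<integral>y. (u (r m) y - u (r n) y) * k (x - y) \<partial>lborel)\<^sup>2) \<partial>lborel"
    have "\<kappa>\<^sup>2 * e / 4 > 0" using \<kappa> e by simp
    from convolution_Cauchy_on_finite_measure[of "\<lambda>n. u (r n)" C k \<Omega>, OF u u2 C weak k_meas k2 \<Omega> fin this]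
    obtain N where N: "\<And>m n. m \<ge> N \<Longrightarrow> n \<ge> N \<Longrightarrow> ?Y m n \<le> ennreal (\<kappa>\<^sup>2 * e / 4)"
      by auto
    have "(\<integral>\<^sup>+x. ennreal ((u (r m) x - u (r n) x)\<^sup>2) \<partial>lborel) \<le> ennreal e" if "m \<ge> N" "n \<ge> N" for m n
    proof -
      let ?X = "\<integral>\<^sup>+x. ennreal ((u (r m) x - u (r n) x)\<^sup>2) \<partial>lborel"
      have w2: "integrable lborel (\<lambda>x. (u (r m) x - u (r n) x)\<^sup>2)"
        by (rule square_integrable_diff) (auto simp: u2)
      have "nonlocal_energy k (\<lambda>x. u (r m) x - u (r n) x) \<le>
          2 * nonlocal_energy k (u (r m)) + 2 * nonlocal_energy k (u (r n))"
        by (rule nonlocal_energy_diff_le) (auto simp: k)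
      also have "\<dots> \<le> 2 * ennreal E' + 2 * ennreal E'"
        by (intro add_mono mult_left_mono energy) simp_all
      also have "\<dots> = ennreal (2 * E' + 2 * E')"
        using E' unfolding two_times_ennreal by (intro ennreal_plus[symmetric]) auto
      finally have en: "nonlocal_energy k (\<lambda>x. u (r m) x - u (r n) x) \<le> ennreal (4 * E')" by simp
      have "ennreal (\<kappa>\<^sup>2) * ?X \<le>
          2 * ennreal \<kappa> * nonlocal_energy k (\<lambda>x. u (r m) x - u (r n) x) + 2 * ?Y m n"
        unfolding \<kappa>_def by (rule nonlocal_estimate[OF k_meas _ k k1 k2 w2 \<Omega>]) (auto simp: supp)
      also have "\<dots> \<le> 2 * ennreal \<kappa> * ennreal (4 * E') + 2 * ennreal (\<kappa>\<^sup>2 * e / 4)"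
        by (intro add_mono mult_left_mono en N that) simp_all
      also have "\<dots> = ennreal (2 * \<kappa> * (4 * E') + 2 * (\<kappa>\<^sup>2 * e / 4))"
        using \<kappa> E' e unfolding two_times_ennreal
        by (subst ennreal_mult[symmetric]) (simp_all flip: ennreal_plus)
      also have "\<dots> \<le> ennreal (\<kappa>\<^sup>2 * e)"
      proof (rule ennreal_leI)
        have "\<kappa> * (16 * E') \<le> \<kappa> * (\<kappa> * e)" using \<kappa> E'\<kappa> by (intro mult_left_mono) auto
        then show "2 * \<kappa> * (4 * E') + 2 * (\<kappa>\<^sup>2 * e / 4) \<le> \<kappa>\<^sup>2 * e"
          by (simp add: power2_eq_square)
      qed
      also have "\<dots> = ennreal (\<kappa>\<^sup>2) * ennreal e" using e by (simp add: ennreal_mult)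
      finally show ?thesis using \<kappa> by (simp add: ennreal_mult_le_mult_iff)
    qed
    then show ?thesis by blast
  qed
  then obtain v where "v \<in> borel_measurable lborel"
    "(\<lambda>n. \<integral>\<^sup>+x. ennreal ((u (r n) x - v x)\<^sup>2) \<partial>lborel) \<longlonglongrightarrow> 0"
    by (rule L2_complete[of "\<lambda>n. u (r n)", OF um])
  with r show ?thesis using that by simp
qed

section \<open>Lebesgue measurable data\<close>

text \<open>Multiplying a Borel version by the indicator of \<Omega> turns vanishing almost
  everywhere outside \<Omega> into vanishing everywhere there, as the estimates on
  \<open>lborel\<close> expect.\<close>

lemma Borel_representative_supported:
  fixes u :: "'a::euclidean_space \<Rightarrow> real"
  assumes u: "u \<in> borel_measurable lebesgue" and \<Omega> [measurable]: "\<Omega> \<in> sets borel"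
    and supp: "AE x in lebesgue. x \<notin> \<Omega> \<longrightarrow> u x = 0"
  obtains v where "v \<in> borel_measurable borel" "\<And>x. x \<notin> \<Omega> \<Longrightarrow> v x = 0" "AE x in lborel. u x = v x"
proof -
  from completion_ex_borel_measurable_real[OF u] obtain g
    where g: "g \<in> borel_measurable lborel" "AE x in lborel. u x = g x" by blast
  show ?thesis
  proof (rule that[of "\<lambda>x. indicator \<Omega> x * g x"])
    show "(\<lambda>x. indicator \<Omega> x * g x) \<in> borel_measurable borel"
      using g(1) by simp
    have "AE x in lborel. x \<notin> \<Omega> \<longrightarrow> u x = 0"
      using supp by (simp add: AE_completion_iff)
    with g(2) show "AE x in lborel. u x = indicator \<Omega> x * g x"
      by eventually_elim (auto simp: indicator_def)
  qed simp
qed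

text \<open>A Borel version is set to 0 on a Borel null set containing all disagreements. It then
  lies below \<open>K\<close> at every point, so k(x - y) <= J(x, y) holds for all pairs without
  exceptional sets of differences.\<close>

lemma Borel_minorant:
  fixes K :: "'a::euclidean_space \<Rightarrow> real"
  assumes K: "K \<in> borel_measurable lebesgue" and nonneg: "\<And>z. 0 \<le> K z"
  obtains k where "k \<in> borel_measurable borel" "\<And>z. 0 \<le> k z" "\<And>z. k z \<le> K z" "AE z in lborel. K z = k z"
proof -
  from completion_ex_borel_measurable_real[OF K] obtain g
    where g: "g \<in> borel_measurable lborel" "AE z in lborel. K z = g z" by blast
  obtain N where "\<And>z. z \<in> space lborel - N \<Longrightarrow> K z = g z" and null: "N \<in> null_sets lborel"
    by (rule AE_E3[OF g(2)], rule that)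
  then have N: "\<And>z. z \<notin> N \<Longrightarrow> K z = g z" by simp
  show ?thesis
  proof (rule that[of "\<lambda>z. indicator (- N) z * g z"])
    have "N \<in> sets borel" using null by auto
    then show "(\<lambda>z. indicator (- N) z * g z) \<in> borel_measurable borel"
      using g(1) by simp
    show "0 \<le> indicator (- N) z * g z" "indicator (- N) z * g z \<le> K z" for z
      using N[of z] nonneg[of z] by (auto simp: indicator_def)
    show "AE z in lborel. K z = indicator (- N) z * g z"
      using AE_not_in[OF null] by eventually_elim (simp add: N)
  qed
qed

text \<open>An exceptional null set \<open>N\<close> produces the cylinders N x UNIV and UNIV x N,
  both null for the product. This justifies changing representatives inside a double
  integral.\<close>

lemma AE_lborel_pair_components:
  assumes "AE x in (lborel :: 'a::euclidean_space measure). P x"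
  shows "AE p in lborel \<Otimes>\<^sub>M (lborel :: 'a measure). P (fst p) \<and> P (snd p)"
proof -
  obtain N where "\<And>x. x \<in> space lborel - N \<Longrightarrow> P x" and null: "N \<in> null_sets lborel"
    by (rule AE_E3[OF assms], rule that)
  then have N: "\<And>x. x \<notin> N \<Longrightarrow> P x" by simp
  have "N \<times> UNIV \<in> null_sets (lborel \<Otimes>\<^sub>M (lborel :: 'a measure))"
    by (rule lborel.times_in_null_sets1) (use null in auto)
  moreover have "UNIV \<times> N \<in> null_sets ((lborel :: 'a measure) \<Otimes>\<^sub>M lborel)"
    by (rule lborel.times_in_null_sets2) (use null in auto)
  ultimately have "AE p in lborel \<Otimes>\<^sub>M (lborel :: 'a measure). p \<notin> N \<times> UNIV \<and> p \<notin> UNIV \<times> N"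
    by (intro AE_conjI AE_not_in)
  then show ?thesis
    by eventually_elim (auto simp: N mem_Times_iff)
qed

text \<open>On \<open>Q_set \<Omega>\<close> the kernels compare pointwise; off it both points lie
  outside \<Omega> and the difference of \<open>v\<close> is 0. The factor 2 cancels the 1/2 in
  \<open>energy\<close>.\<close>

lemma nonlocal_energy_le_energy:
  fixes u v :: "'a::euclidean_space \<Rightarrow> real"
  assumes v: "v \<in> borel_measurable borel" and supp: "\<And>x. x \<notin> \<Omega> \<Longrightarrow> v x = 0"
    and uv: "AE x in lborel. u x = v x"
    and k: "\<And>z. 0 \<le> k z" and kJ: "\<And>x y. k (x - y) \<le> J x y"
  shows "nonlocal_energy k v \<le> 2 * energy \<Omega> J u"
proof -
  have "nonlocal_energy k v \<le> (\<integral>\<^sup>+ p. indicator (Q_set \<Omega>) p *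
      ennreal ((u (fst p) - u (snd p))\<^sup>2 * J (fst p) (snd p)) \<partial>(lborel \<Otimes>\<^sub>M lborel))"
    unfolding nonlocal_energy_def
  proof (rule nn_integral_mono_AE)
    show "AE p in lborel \<Otimes>\<^sub>M lborel. ennreal (k (fst p - snd p) * (v (fst p) - v (snd p))\<^sup>2) \<le>
        indicator (Q_set \<Omega>) p * ennreal ((u (fst p) - u (snd p))\<^sup>2 * J (fst p) (snd p))"
      using AE_lborel_pair_components[OF uv]
    proof eventually_elim
      fix p :: "'a \<times> 'a"
      assume p: "u (fst p) = v (fst p) \<and> u (snd p) = v (snd p)"
      show "ennreal (k (fst p - snd p) * (v (fst p) - v (snd p))\<^sup>2) \<le>
        indicator (Q_set \<Omega>) p * ennreal ((u (fst p) - u (snd p))\<^sup>2 * J (fst p) (snd p))"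
      proof (cases "p \<in> Q_set \<Omega>")
        case True
        have "k (fst p - snd p) * (v (fst p) - v (snd p))\<^sup>2 \<le> J (fst p) (snd p) * (v (fst p) - v (snd p))\<^sup>2"
          by (intro mult_right_mono kJ) simp
        with True p show ?thesis by (simp add: ennreal_leI mult.commute)
      next
        case False
        then have "fst p \<notin> \<Omega>" "snd p \<notin> \<Omega>" by (auto simp: Q_set_def mem_Times_iff)
        then show ?thesis by (simp add: supp)
      qed
    qed
  qed
  also have "\<dots> = 2 * energy \<Omega> J u"
  proof -
    have "2 * ennreal (1/2) = 1" unfolding two_times_ennreal by simp
    then show ?thesis
      \<comment> \<open>Lebesgue measure on pairs is the completion of \<open>lborel\<close>, which
        is in turn the product of the two \<open>lborel\<close> factors.\<close>
      unfolding energy_def nn_integral_completion lborel_prod mult.assoc[symmetric] by (simp only: mult_1)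
  qed
  finally show ?thesis .
qed

text \<open>Cutting at height \<open>m\<close> on the unit ball gives bounded functions of bounded
  support, hence integrable and square integrable. They increase with \<open>m\<close> to a function
  of infinite integral, so by monotone convergence their masses exceed any \<open>c\<close>.\<close>

lemma bounded_kernels_below_nonintegrable_kernel:
  fixes K :: "'a::euclidean_space \<Rightarrow> real"
  assumes K: "K \<in> borel_measurable lebesgue" and nonneg: "\<And>z. 0 \<le> K z"
    and nonint: "\<not> integrable lebesgue (\<lambda>z. indicator (ball 0 1) z * K z)"
  shows "\<exists>k\<in>borel_measurable borel. (\<forall>z. 0 \<le> k z \<and> k z \<le> K z) \<and> integrable lborel k \<and>
      integrable lborel (\<lambda>z. (k z)\<^sup>2) \<and> c < (\<integral>z. k z \<partial>lborel)"
proof -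
  obtain K' where K' [measurable]: "K' \<in> borel_measurable borel" and K'0: "\<And>z. 0 \<le> K' z"
    and K'K: "\<And>z. K' z \<le> K z" and ae: "AE z in lborel. K z = K' z"
    by (rule Borel_minorant[OF K nonneg], rule that)
  let ?B = "ball 0 1 :: 'a set"
  define k where "k m z = indicator ?B z * min (K' z) (real m)" for m :: nat and z
  have k_meas [measurable]: "k m \<in> borel_measurable borel" for m
    unfolding k_def
    by (intro borel_measurable_times borel_measurable_indicator borel_measurable_min K' borel_measurable_const) simp
  have k0: "0 \<le> k m z" and kK: "k m z \<le> K z" and km: "k m z \<le> real m * indicator ?B z" for m z
    using K'0[of z] K'K[of z] nonneg[of z] by (auto simp: k_def indicator_def)
  have finB: "emeasure lborel ?B < \<infinity>"
    by (rule emeasure_bounded_finite) simp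
  have k1: "integrable lborel (k m)" for m
  proof (rule Bochner_Integration.integrable_bound)
    show "integrable lborel (\<lambda>z. real m * indicator ?B z)" using finB by simp
    show "AE z in lborel. norm (k m z) \<le> norm (real m * indicator ?B z)"
      using k0 km by (intro AE_I2) simp
  qed simp
  have k2: "integrable lborel (\<lambda>z. (k m z)\<^sup>2)" for m
  proof (rule Bochner_Integration.integrable_bound)
    show "integrable lborel (\<lambda>z. real m * k m z)" using k1 by simp
    have "(k m z)\<^sup>2 \<le> real m * k m z" for z
      unfolding power2_eq_square using k0[of m z] km[of m z]
      by (intro mult_right_mono) (cases "z \<in> ball 0 1"; simp)+
    then show "AE z in lborel. norm ((k m z)\<^sup>2) \<le> norm (real m * k m z)"
      using k0 by (intro AE_I2) simp
  qed simp
  \<comment> \<open>For a nonnegative measurable function, failure of integrability can only mean an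
    infinite integral.\<close>
  have "(\<integral>\<^sup>+z. ennreal (indicator ?B z * K z) \<partial>lebesgue) = \<infinity>"
  proof (rule ccontr)
    assume "\<not> ?thesis"
    moreover have "(\<lambda>z. indicator ?B z * K z) \<in> borel_measurable lebesgue"
      by (intro borel_measurable_times borel_measurable_indicator K) simp
    ultimately have "integrable lebesgue (\<lambda>z. indicator ?B z * K z)"
      using nonneg by (intro integrableI_nonneg) (auto simp: less_top)
    with nonint show False by simp
  qed
  then have inf: "(\<integral>\<^sup>+z. ennreal (indicator ?B z * K' z) \<partial>lborel) = \<infinity>"
    unfolding nn_integral_completion
    by (subst nn_integral_cong_AE[of _ "\<lambda>z. ennreal (indicator ?B z * K z)"]) (use ae in auto)
  have "(\<lambda>m. \<integral>\<^sup>+z. ennreal (k m z) \<partial>lborel) \<longlonglongrightarrow> (\<integral>\<^sup>+z. ennreal (indicator ?B z * K' z) \<partial>lborel)"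
  proof (rule nn_integral_LIMSEQ)
    show "incseq (\<lambda>m z. ennreal (k m z))"
      unfolding incseq_def le_fun_def k_def
      by (auto intro!: ennreal_leI mult_left_mono)
    fix z
    obtain m0 :: nat where "K' z \<le> real m0" using real_arch_simple by blast
    then have "\<forall>\<^sub>F m in sequentially. ennreal (k m z) = ennreal (indicator ?B z * K' z)"
      unfolding eventually_sequentially k_def by (intro exI[of _ m0]) (auto simp: min_def)
    then show "(\<lambda>m. ennreal (k m z)) \<longlonglongrightarrow> ennreal (indicator ?B z * K' z)"
      by (rule tendsto_eventually)
  qed simp
  \<comment> \<open>A negative \<open>c\<close> would be lost under \<open>ennreal\<close>;
    comparing with \<open>max 0 c\<close> gives a real inequality that implies the one for
    \<open>c\<close>.\<close>
  then have "\<forall>\<^sub>F m in sequentially. ennreal (max 0 c) < (\<integral>\<^sup>+z. ennreal (k m z) \<partial>lborel)"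
    unfolding inf by (rule order_tendstoD(1)) simp
  then obtain m where "ennreal (max 0 c) < (\<integral>\<^sup>+z. ennreal (k m z) \<partial>lborel)"
    unfolding eventually_sequentially by blast
  then have "ennreal (max 0 c) < ennreal (\<integral>z. k m z \<partial>lborel)"
    using k1 k0 by (simp add: nn_integral_eq_integral)
  then have "c < (\<integral>z. k m z \<partial>lborel)"
    by (simp add: ennreal_less_iff)
  with k0 kK k1 k2 k_meas show ?thesis by blast
qed

text \<open>Relative compactness in the metric space L2(\<Omega>) is expressed sequentially: every
  sequence in \<open>S\<close> has a subsequence with a limit in L2(\<Omega>), which need not belong
  to \<open>S\<close>.\<close>

theorem mainTheorem1:
  fixes \<Omega> :: "'a::euclidean_space set"
    and J :: "'a \<Rightarrow> 'a \<Rightarrow> real" and K :: "'a \<Rightarrow> real"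
    and \<rho> :: real and l :: "real \<Rightarrow> real"
    and S :: "('a \<Rightarrow> real) set" and f :: "nat \<Rightarrow> 'a \<Rightarrow> real"
  assumes "open \<Omega>" and "bounded \<Omega>"
    and "H0 J" and "H0' J K" and "H1 K \<rho> l" and "H2 l"
    and "S \<subseteq> HJ0 \<Omega> J" and "\<exists>C. \<forall>u\<in>S. HJ_norm \<Omega> J u \<le> C"
    and "\<forall>n. f n \<in> S"
  shows "\<exists>r v. strict_mono r \<and> v \<in> borel_measurable lebesgue \<and> L2_part \<Omega> v < \<infinity> \<and>
           (\<lambda>n. L2_part \<Omega> (\<lambda>x. f (r n) x - v x)) \<longlonglongrightarrow> 0"
proof -
  obtain C where C: "\<And>n. HJ_norm \<Omega> J (f n) \<le> C" using assms(8,9) by blast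
  have f: "f n \<in> borel_measurable lebesgue" "L2_part \<Omega> (f n) < \<infinity>" "energy \<Omega> J (f n) < \<infinity>"
    "AE x in lebesgue. x \<notin> \<Omega> \<longrightarrow> f n x = 0" for n
    using assms(7,9) unfolding HJ0_def HJ_def by auto
  have \<Omega> [measurable]: "\<Omega> \<in> sets borel" using assms(1) by simp
  have fin: "emeasure lborel \<Omega> < \<infinity>" using assms(2) by (rule emeasure_bounded_finite)
  \<comment> \<open>\<open>enn2real\<close> sends infinity to 0, so the norm bound alone would not
    control the sum; finiteness comes from membership in \<open>HJ\<close>.\<close>
  have total: "L2_part \<Omega> (f n) + energy \<Omega> J (f n) \<le> ennreal (C\<^sup>2)" for n
  proof -
    have "enn2real (L2_part \<Omega> (f n) + energy \<Omega> J (f n)) \<le> C\<^sup>2"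
      using C[of n] unfolding HJ_norm_def by (rule sqrt_le_D)
    then have "ennreal (enn2real (L2_part \<Omega> (f n) + energy \<Omega> J (f n))) \<le> ennreal (C\<^sup>2)"
      by (rule ennreal_leI)
    moreover have "L2_part \<Omega> (f n) + energy \<Omega> J (f n) < top"
      using f(2,3)[of n] by simp
    ultimately show ?thesis by (simp only: ennreal_enn2real)
  qed
  have "\<exists>v. v \<in> borel_measurable borel \<and> (\<forall>x. x \<notin> \<Omega> \<longrightarrow> v x = 0) \<and> (AE x in lborel. f n x = v x)" for n
    using Borel_representative_supported[OF f(1) \<Omega> f(4)] by metis
  then obtain u where u [measurable]: "\<And>n. u n \<in> borel_measurable borel"
    and supp: "\<And>n x. x \<notin> \<Omega> \<Longrightarrow> u n x = 0" and fu: "\<And>n. AE x in lborel. f n x = u n x"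
    by metis
  have "(\<integral>\<^sup>+x. ennreal ((u n x)\<^sup>2) \<partial>lborel) = L2_part \<Omega> (f n)" for n
    unfolding L2_part_def nn_integral_completion
    by (rule nn_integral_cong_AE) (use fu[of n] supp[of _ n] in \<open>auto simp: indicator_def elim!: eventually_mono\<close>)
  then have nn: "(\<integral>\<^sup>+x. ennreal ((u n x)\<^sup>2) \<partial>lborel) \<le> ennreal (C\<^sup>2)" for n
    using total[of n] by (metis add_increasing2 dual_order.trans le_iff_add)
  have u2: "integrable lborel (\<lambda>x. (u n x)\<^sup>2)" for n
    by (rule integrableI_nonneg) (use nn[of n] in \<open>auto simp: le_less_trans\<close>)
  have uC: "(\<integral>x. (u n x)\<^sup>2 \<partial>lborel) \<le> C\<^sup>2" for n
    using nn[of n] u2[of n] by (simp add: nn_integral_eq_integral)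
  have K: "K \<in> borel_measurable lebesgue" "\<And>z. 0 \<le> K z" "\<And>x y. K (x - y) \<le> J x y"
    "\<not> integrable lebesgue (\<lambda>z. indicator (ball 0 1) z * K z)"
    using assms(4) unfolding H0'_def by auto
  \<comment> \<open>The bound depends on \<open>C\<close> only and not on the minorant
    \<open>k\<close>, so the mass of \<open>k\<close> may grow freely.\<close>
  have energy: "nonlocal_energy k (u n) \<le> ennreal (2 * C\<^sup>2)" if "\<And>z. 0 \<le> k z" "\<And>z. k z \<le> K z" for k n
  proof -
    have "k (x - y) \<le> J x y" for x y using that(2)[of "x - y"] K(3)[of x y] by linarith
    then have "nonlocal_energy k (u n) \<le> 2 * energy \<Omega> J (f n)"
      by (intro nonlocal_energy_le_energy u supp fu that(1))
    also have "\<dots> \<le> 2 * ennreal (C\<^sup>2)"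
      using total[of n] by (intro mult_left_mono) (auto intro: order_trans[rotated])
    finally show ?thesis by (simp add: two_times_ennreal)
  qed
  have kernels: "\<exists>k\<in>borel_measurable borel. (\<forall>z. 0 \<le> k z) \<and> integrable lborel k \<and>
      integrable lborel (\<lambda>z. (k z)\<^sup>2) \<and> c < (\<integral>z. k z \<partial>lborel) \<and> (\<forall>n. nonlocal_energy k (u n) \<le> ennreal (2 * C\<^sup>2))"
    for c
    using bounded_kernels_below_nonintegrable_kernel[OF K(1,2,4), of c] energy by meson
  obtain r v where r: "strict_mono r" and v [measurable]: "v \<in> borel_measurable borel"
    and lim: "(\<lambda>n. \<integral>\<^sup>+x. ennreal ((u (r n) x - v x)\<^sup>2) \<partial>lborel) \<longlonglongrightarrow> 0"
    by (rule nonlocal_energy_compactness[of u, OF u u2 uC \<Omega> fin supp kernels])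
  have le: "L2_part \<Omega> (\<lambda>x. f (r n) x - v x) \<le> (\<integral>\<^sup>+x. ennreal ((u (r n) x - v x)\<^sup>2) \<partial>lborel)" for n
    unfolding L2_part_def nn_integral_completion
    by (rule nn_integral_mono_AE) (use fu[of "r n"] in \<open>auto simp: indicator_def elim!: eventually_mono\<close>)
  have "(\<lambda>n. L2_part \<Omega> (\<lambda>x. f (r n) x - v x)) \<longlonglongrightarrow> 0"
    by (rule tendsto_sandwich[OF _ _ tendsto_const lim]) (auto simp: le)
  \<comment> \<open>For one large \<open>n\<close> both \<open>u (r n)\<close> and
    \<open>u (r n) - v\<close> are square integrable, hence so is their difference
    \<open>v\<close>.\<close>
  moreover have "L2_part \<Omega> v < \<infinity>"
  proof -
    have "\<forall>\<^sub>F n in sequentially. (\<integral>\<^sup>+x. ennreal ((u (r n) x - v x)\<^sup>2) \<partial>lborel) < 1"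
      using lim by (rule order_tendstoD(2)) simp
    then obtain n where n: "(\<integral>\<^sup>+x. ennreal ((u (r n) x - v x)\<^sup>2) \<partial>lborel) < 1"
      unfolding eventually_sequentially by blast
    then have "integrable lborel (\<lambda>x. (u (r n) x - v x)\<^sup>2)"
      by (intro integrableI_nonneg) (auto intro: less_trans)
    from square_integrable_diff[OF _ _ u2[of "r n"] this] have "integrable lborel (\<lambda>x. (v x)\<^sup>2)"
      by simp
    then have "(\<integral>\<^sup>+x. ennreal ((v x)\<^sup>2) \<partial>lborel) < \<infinity>"
      by (simp add: nn_integral_eq_integral)
    moreover have "L2_part \<Omega> v \<le> (\<integral>\<^sup>+x. ennreal ((v x)\<^sup>2) \<partial>lborel)"
      unfolding L2_part_def nn_integral_completion
      by (rule nn_integral_mono) (simp add: indicator_def)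
    ultimately show ?thesis by (rule le_less_trans[rotated])
  qed
  moreover have "v \<in> borel_measurable lebesgue"
    using v by (simp add: measurable_completion)
  ultimately show ?thesis using r by blast
qed

end
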